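(* Let $M$ be a $3$-dimensional proper CR submanifold of the nearly Kähler manifold $(\mathbb{S}^3\times\mathbb{S}^3,g,J)$ such that $P\mathcal{D}_1=\mathcal{D}_2$. Then $M$ is locally congruent to the immersion $f(u,v,t)=(p(u,v,t),q(u,v,t))$ given by \begin{align*} p(u,v,t)=A\Big(&\cos\big(\sqrt{\tfrac32}u-\tfrac{1}{\sqrt2}v\big)+\sin\big(\sqrt{\tfrac32}u-\tfrac{1}{\sqrt2}v\big)i\\ &+\sqrt3\sin\big(\sqrt{\tfrac23}t+\tfrac{1}{\sqrt6}u+\tfrac{1}{\sqrt2}v\big)j+\sqrt3\cos\big(\sqrt{\tfrac23}t+\tfrac{1}{\sqrt6}u+\tfrac{1}{\sqrt2}v\big)k\Big),\\ q(u,v,t)=E\Big(&\cos\big(\sqrt{\tfrac32}u+\tfrac{1}{\sqrt2}v\big)+\sin\big(\sqrt{\tfrac32}u+\tfrac{1}{\sqrt2}v\big)i\\ &-\sqrt3\sin\big(\sqrt{\tfrac23}t+\tfrac{1}{\sqrt6}u-\tfrac{1}{\sqrt2}v\big)j-\sqrt3\cos\big(\sqrt{\tfrac23}t+\tfrac{1}{\sqrt6}u-\tfrac{1}{\sqrt2}v\big)k\Big), \end{align*} where $A,E\in\mathbb{H}$ are constants with $\|A\|=\|E\|=\frac12$.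
   Context: Identify $\mathbb{S}^3$ with the unit quaternions in $\mathbb{H}=\mathbb{R}^4$ with standard imaginary units $i,j,k$. A tangent vector of $\mathbb{S}^3\times\mathbb{S}^3$ at $(p,q)$ is written $Z=(p\alpha,q\beta)$ with $\alpha,\beta\in\mathrm{Im}\,\mathbb{H}$. The almost complex structure is $J(p\alpha,q\beta)=\frac{1}{\sqrt3}\big(p(2\beta-\alpha),q(-2\alpha+\beta)\big)$, and the nearly Kähler metric is $g(Z,Z')=\frac12(\langle Z,Z'\rangle+\langle JZ,JZ'\rangle)$, where $\langle\cdot,\cdot\rangle$ is the standard product metric induced from $\mathbb{R}^4\times\mathbb{R}^4$. The almost product structure $P$ is $P(p\alpha,q\beta)=(p\beta,q\alpha)$. All objects are smooth. A submanifold $M$ is a CR submanifold if there is a smooth distribution $\mathcal{D}_1\subseteq TM$ with $J\mathcal{D}_1=\mathcal{D}_1$ whose $g$-orthogonal complement $\mathcal{D}_1^\perp$ in $TM$ is totally real, i.e. $J\mathcal{D}_1^\perp\subseteq T^\perp M$. It is proper if it is neither almost complex nor totally real. For a $3$-dimensional proper CR submanifold, $\mathcal{D}_1=JTM\cap TM$ has rank $2$ and $\mathcal{D}_1^\perp$ has rank $1$. Along such $M$ put $\mathcal{D}_2=\mathcal{D}_1^\perp\oplus J\mathcal{D}_1^\perp$, a $J$-invariant rank-$2$ subbundle of $T(\mathbb{S}^3\times\mathbb{S}^3)|_M$. For unit quaternions $a,b,c$, the map $\mathcal{F}_{abc}(p,q)=(ap\bar c,bq\bar c)$ is an isometry of $(\mathbb{S}^3\times\mathbb{S}^3,g)$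 preserving $J$ and $P$. "$M$ is locally congruent to the immersion $f$" means: each point of $M$ has a neighbourhood which is the image, under some $\mathcal{F}_{abc}$, of the restriction of $f$ to an open set of parameters. *)

theory Defs
  imports "HOL-Analysis.Analysis"
begin

section \<open>Quaternions on \<open>\<real>\<^sup>4\<close>\<close>

type_synonym quat = "real ^ 4"

definition qone :: quat where "qone = vector [1, 0, 0, 0]"
definition qi :: quat where "qi = vector [0, 1, 0, 0]"
definition qj :: quat where "qj = vector [0, 0, 1, 0]"
definition qk :: quat where "qk = vector [0, 0, 0, 1]"

definition qmult :: "quat \<Rightarrow> quat \<Rightarrow> quat"  (infixl "\<star>" 70) where
  "x \<star> y = vector
     [x$1 * y$1 - x$2 * y$2 - x$3 * y$3 - x$4 * y$4,
      x$1 * y$2 + x$2 * y$1 + x$3 * y$4 - x$4 * y$3,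
      x$1 * y$3 - x$2 * y$4 + x$3 * y$1 + x$4 * y$2,
      x$1 * y$4 + x$2 * y$3 - x$3 * y$2 + x$4 * y$1]"

definition qcnj :: "quat \<Rightarrow> quat" where
  "qcnj x = vector [x$1, - x$2, - x$3, - x$4]"

definition Im_quat :: "quat set" where
  "Im_quat = {x. x$1 = 0}"

definition S3 :: "quat set" where
  "S3 = {x. norm x = 1}"


section \<open>The nearly Kaehler manifold \<open>S\<^sup>3 \<times> S\<^sup>3\<close>\<close>

definition tangent_S3S3 :: "quat \<times> quat \<Rightarrow> (quat \<times> quat) set" where
  "tangent_S3S3 z = {(fst z \<star> \<alpha>, snd z \<star> \<beta>) | \<alpha> \<beta>. \<alpha> \<in> Im_quat \<and> \<beta> \<in> Im_quat}"

text \<open>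
  For \<open>Z = (p \<star> \<alpha>, q \<star> \<beta>)\<close> tangent at \<open>(p, q)\<close> one recovers \<open>\<alpha> = qcnj p \<star> fst Z\<close> and
  \<open>\<beta> = qcnj q \<star> snd Z\<close>, because \<open>p\<close> and \<open>q\<close> are unit quaternions. The operators below are total,
  but are meant for \<open>z \<in> S3 \<times> S3\<close> and \<open>Z \<in> tangent_S3S3 z\<close>.
\<close>

definition J_op :: "quat \<times> quat \<Rightarrow> quat \<times> quat \<Rightarrow> quat \<times> quat" where
  "J_op z Z =
     (let p = fst z; q = snd z; \<alpha> = qcnj p \<star> fst Z; \<beta> = qcnj q \<star> snd Z
      in (1 / sqrt 3) *\<^sub>R (p \<star> (2 *\<^sub>R \<beta> - \<alpha>), q \<star> (- 2 *\<^sub>R \<alpha> + \<beta>)))"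

definition P_op :: "quat \<times> quat \<Rightarrow> quat \<times> quat \<Rightarrow> quat \<times> quat" where
  "P_op z Z =
     (let p = fst z; q = snd z; \<alpha> = qcnj p \<star> fst Z; \<beta> = qcnj q \<star> snd Z
      in (p \<star> \<beta>, q \<star> \<alpha>))"

definition g_metric :: "quat \<times> quat \<Rightarrow> quat \<times> quat \<Rightarrow> quat \<times> quat \<Rightarrow> real" where
  "g_metric z Z Z' = (1 / 2) * (Z \<bullet> Z' + J_op z Z \<bullet> J_op z Z')"

definition isom :: "quat \<Rightarrow> quat \<Rightarrow> quat \<Rightarrow> quat \<times> quat \<Rightarrow> quat \<times> quat" where
  "isom a b c z = (a \<star> fst z \<star> qcnj c, b \<star> snd z \<star> qcnj c)"


section \<open>Smooth maps\<close>

text \<open>\<open>Ck_on k S f\<close>: all iterated directional derivatives of \<open>f\<close> of order at most \<open>k\<close> exist as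
  Frechet derivatives and are continuous on the open set \<open>S\<close>.\<close>

primrec Ck_on :: "nat \<Rightarrow> 'a set \<Rightarrow> ('a::real_normed_vector \<Rightarrow> 'b::real_normed_vector) \<Rightarrow> bool" where
  "Ck_on 0 S f \<longleftrightarrow> continuous_on S f"
| "Ck_on (Suc k) S f \<longleftrightarrow>
     (\<forall>x\<in>S. f differentiable (at x)) \<and> (\<forall>v. Ck_on k S (\<lambda>x. frechet_derivative f (at x) v))"

definition smooth_on :: "'a set \<Rightarrow> ('a::real_normed_vector \<Rightarrow> 'b::real_normed_vector) \<Rightarrow> bool" where
  "smooth_on S f \<longleftrightarrow> open S \<and> (\<forall>k. Ck_on k S f)"


section \<open>Immersed three-dimensional submanifolds\<close>

text \<open>
  A submanifold is a topological manifold \<open>N\<close> with a map \<open>F\<close> into \<open>S3 \<times> S3\<close> which in suitable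
  local parametrizations \<open>\<psi> : U \<rightarrow> N\<close>, \<open>U \<subseteq> \<real>\<^sup>3\<close> open, is a smooth immersion. Since \<open>F\<close> is locally
  a smooth embedding in such parametrizations, any two of them are smoothly compatible, so they form
  the atlas of the smooth structure making \<open>F\<close> an immersion. Embedded submanifolds \<open>M\<close> are
  the case \<open>N = top_of_set M\<close>, \<open>F = id\<close>.
\<close>

definition param ::
  "'n topology \<Rightarrow> ('n \<Rightarrow> quat \<times> quat) \<Rightarrow> (real ^ 3) set \<Rightarrow> (real ^ 3 \<Rightarrow> 'n) \<Rightarrow> bool" where
  "param N F U \<psi> \<longleftrightarrow>
     open U \<and> openin N (\<psi> ` U) \<and>
     homeomorphic_map (top_of_set U) (subtopology N (\<psi> ` U)) \<psi> \<and>
     smooth_on U (F \<circ> \<psi>) \<and>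
     (\<forall>u\<in>U. inj (frechet_derivative (F \<circ> \<psi>) (at u)))"

definition submanifold3 :: "'n topology \<Rightarrow> ('n \<Rightarrow> quat \<times> quat) \<Rightarrow> bool" where
  "submanifold3 N F \<longleftrightarrow>
     Hausdorff_space N \<and> second_countable N \<and>
     F ` topspace N \<subseteq> S3 \<times> S3 \<and>
     (\<forall>x\<in>topspace N. \<exists>U \<psi>. param N F U \<psi> \<and> x \<in> \<psi> ` U)"

text \<open>Tangent vectors of \<open>N\<close> are identified with their images under the differential of \<open>F\<close>.\<close>

definition tangent :: "'n topology \<Rightarrow> ('n \<Rightarrow> quat \<times> quat) \<Rightarrow> 'n \<Rightarrow> (quat \<times> quat) set" where
  "tangent N F x =
     {frechet_derivative (F \<circ> \<psi>) (at u) w | U \<psi> u w. param N F U \<psi> \<and> u \<in> U \<and> \<psi> u = x}"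

definition normal :: "'n topology \<Rightarrow> ('n \<Rightarrow> quat \<times> quat) \<Rightarrow> 'n \<Rightarrow> (quat \<times> quat) set" where
  "normal N F x =
     {Z \<in> tangent_S3S3 (F x). \<forall>Y\<in>tangent N F x. g_metric (F x) Z Y = 0}"

text \<open>Smooth subbundles of the tangent bundle, of constant rank, given by smooth local frames.\<close>

definition smooth_distribution ::
  "'n topology \<Rightarrow> ('n \<Rightarrow> quat \<times> quat) \<Rightarrow> ('n \<Rightarrow> (quat \<times> quat) set) \<Rightarrow> bool" where
  "smooth_distribution N F D \<longleftrightarrow>
     (\<forall>x\<in>topspace N. D x \<subseteq> tangent N F x) \<and>
     (\<exists>k. \<forall>x\<in>topspace N. \<exists>U \<psi> X.
        param N F U \<psi> \<and> x \<in> \<psi> ` U \<and>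
        (\<forall>i<k. smooth_on U (X i)) \<and>
        (\<forall>u\<in>U. D (\<psi> u) = span ((\<lambda>i::nat. X i u) ` {..<k}) \<and> dim (D (\<psi> u)) = k))"


section \<open>CR submanifolds\<close>

definition perp_in_tangent ::
  "'n topology \<Rightarrow> ('n \<Rightarrow> quat \<times> quat) \<Rightarrow> ('n \<Rightarrow> (quat \<times> quat) set) \<Rightarrow> 'n \<Rightarrow> (quat \<times> quat) set"
  where
  "perp_in_tangent N F D x =
     {Z \<in> tangent N F x. \<forall>Y\<in>D x. g_metric (F x) Z Y = 0}"

definition CR_submanifold3 :: "'n topology \<Rightarrow> ('n \<Rightarrow> quat \<times> quat) \<Rightarrow> bool" where
  "CR_submanifold3 N F \<longleftrightarrow>
     submanifold3 N F \<and>
     (\<exists>D. smooth_distribution N F D \<and>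
          (\<forall>x\<in>topspace N. J_op (F x) ` D x = D x \<and>
                          J_op (F x) ` perp_in_tangent N F D x \<subseteq> normal N F x))"

definition almost_complex :: "'n topology \<Rightarrow> ('n \<Rightarrow> quat \<times> quat) \<Rightarrow> bool" where
  "almost_complex N F \<longleftrightarrow>
     (\<forall>x\<in>topspace N. J_op (F x) ` tangent N F x \<subseteq> tangent N F x)"

definition totally_real :: "'n topology \<Rightarrow> ('n \<Rightarrow> quat \<times> quat) \<Rightarrow> bool" where
  "totally_real N F \<longleftrightarrow>
     (\<forall>x\<in>topspace N. J_op (F x) ` tangent N F x \<subseteq> normal N F x)"

definition proper_CR_submanifold3 :: "'n topology \<Rightarrow> ('n \<Rightarrow> quat \<times> quat) \<Rightarrow> bool" where
  "proper_CR_submanifold3 N F \<longleftrightarrow>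
     CR_submanifold3 N F \<and> \<not> almost_complex N F \<and> \<not> totally_real N F"

definition D1 :: "'n topology \<Rightarrow> ('n \<Rightarrow> quat \<times> quat) \<Rightarrow> 'n \<Rightarrow> (quat \<times> quat) set" where
  "D1 N F x = J_op (F x) ` tangent N F x \<inter> tangent N F x"

definition D2 :: "'n topology \<Rightarrow> ('n \<Rightarrow> quat \<times> quat) \<Rightarrow> 'n \<Rightarrow> (quat \<times> quat) set" where
  "D2 N F x =
     {Y + Z | Y Z. Y \<in> perp_in_tangent N F (D1 N F) x \<and>
                   Z \<in> J_op (F x) ` perp_in_tangent N F (D1 N F) x}"


section \<open>The model immersion and local congruence\<close>

definition model_p :: "quat \<Rightarrow> real \<Rightarrow> real \<Rightarrow> real \<Rightarrow> quat" where
  "model_p A u v t = A \<star>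
     (cos (sqrt (3/2) * u - (1 / sqrt 2) * v) *\<^sub>R qone
      + sin (sqrt (3/2) * u - (1 / sqrt 2) * v) *\<^sub>R qi
      + (sqrt 3 * sin (sqrt (2/3) * t + (1 / sqrt 6) * u + (1 / sqrt 2) * v)) *\<^sub>R qj
      + (sqrt 3 * cos (sqrt (2/3) * t + (1 / sqrt 6) * u + (1 / sqrt 2) * v)) *\<^sub>R qk)"

definition model_q :: "quat \<Rightarrow> real \<Rightarrow> real \<Rightarrow> real \<Rightarrow> quat" where
  "model_q E u v t = E \<star>
     (cos (sqrt (3/2) * u + (1 / sqrt 2) * v) *\<^sub>R qone
      + sin (sqrt (3/2) * u + (1 / sqrt 2) * v) *\<^sub>R qi
      - (sqrt 3 * sin (sqrt (2/3) * t + (1 / sqrt 6) * u - (1 / sqrt 2) * v)) *\<^sub>R qj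
      - (sqrt 3 * cos (sqrt (2/3) * t + (1 / sqrt 6) * u - (1 / sqrt 2) * v)) *\<^sub>R qk)"

definition model :: "quat \<Rightarrow> quat \<Rightarrow> real ^ 3 \<Rightarrow> quat \<times> quat" where
  "model A E w = (model_p A (w$1) (w$2) (w$3), model_q E (w$1) (w$2) (w$3))"

text \<open>As \<open>N\<close> is only immersed, a neighbourhood \<open>W\<close> is compared with the model through its image
  \<open>F ` W\<close>; injectivity of \<open>F\<close> on \<open>W\<close> lets \<open>W\<close> be identified with that image.\<close>

definition locally_congruent ::
  "'n topology \<Rightarrow> ('n \<Rightarrow> quat \<times> quat) \<Rightarrow> (real ^ 3 \<Rightarrow> quat \<times> quat) \<Rightarrow> bool" where
  "locally_congruent N F f \<longleftrightarrow>
     (\<forall>x\<in>topspace N. \<exists>W V a b c.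
        openin N W \<and> x \<in> W \<and> inj_on F W \<and> open V \<and>
        norm a = 1 \<and> norm b = 1 \<and> norm c = 1 \<and>
        F ` W = isom a b c ` f ` V)"

end

theory Submission
  imports Defs
begin

text \<open>
  Identify the tangent spaces of \<open>S\<^sup>3 \<times> S\<^sup>3\<close> with \<open>\<complex>\<^sup>3\<close>, with \<open>J\<close> as multiplication by \<open>\<i>\<close> and \<open>P\<close> as
  complex conjugation. The condition \<open>P D1 = D2\<close> then says that there are orthonormal \<open>e1, e2 \<in> \<real>\<^sup>3\<close>
  such that the tangent space of \<open>M\<close> is spanned by \<open>e1\<close>, \<open>\<i> e2\<close> and \<open>\<i> e1 - e2\<close>. Differentiating
  the linear relations that define this space, and using the Maurer--Cartan equations and the symmetry
  of the second derivative of \<open>e1\<close>, shows that \<open>e1\<close> is constant and determines \<open>de2\<close>. It follows that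
  \<open>p (- e1 / 2 + sqrt 3 e2 / 2) p\<^sup>-\<^sup>1\<close> and \<open>q (- e1 / 2 - sqrt 3 e2 / 2) q\<^sup>-\<^sup>1\<close> are constant. After a
  rotation these two constants and \<open>e1\<close> all equal \<open>i\<close>, which places \<open>p\<close> and \<open>q\<close> on Clifford-type tori
  whose angles are the arguments in the model immersion; as both conjugations recover the same \<open>e2\<close>,
  one of the four angles is redundant. The parameters so obtained depend continuously and
  injectively on the point of \<open>M\<close>, hence fill an open set by invariance of domain.
\<close>

section \<open>Smooth maps\<close>

text \<open>The direction comes before the point, so that \<open>dder f v\<close> is again a map and
  second derivatives are obtained by nesting.\<close>

abbreviation dder :: "('a::real_normed_vector \<Rightarrow> 'b::real_normed_vector) \<Rightarrow> 'a \<Rightarrow> 'a \<Rightarrow> 'b" where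
  "dder f v \<equiv> \<lambda>x. frechet_derivative f (at x) v"

lemma dder_eqI: "(f has_derivative f') (at u) \<Longrightarrow> dder f v u = f' v"
  by (simp add: frechet_derivative_at[symmetric])

text \<open>The derivative at a point of \<open>S\<close> only sees a neighbourhood, which openness
  keeps inside \<open>S\<close>; values elsewhere are irrelevant.\<close>

lemma Ck_on_cong:
  assumes "open S" "\<And>x. x \<in> S \<Longrightarrow> f x = g x" "Ck_on k S f"
  shows "Ck_on k S g"
  using assms(2,3)
proof (induction k arbitrary: f g)
  case 0
  then show ?case by (simp cong: continuous_on_cong_simp)
next
  case (Suc k)
  have d: "(g has_derivative frechet_derivative f (at x)) (at x)" if "x \<in> S" for x
    using Suc.prems that has_derivative_transform_within_open[OF _ assms(1) that]
    by (metis Ck_on.simps(2) frechet_derivative_works)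
  have "Ck_on k S (dder g v)" for v
  proof (rule Suc.IH)
    show "dder f v x = dder g v x" if "x \<in> S" for x
      using dder_eqI[OF d[OF that]] by simp
    show "Ck_on k S (dder f v)" using Suc.prems by simp
  qed
  then show ?case using d by (auto simp: differentiable_def)
qed

text \<open>Replaces the chosen \<open>frechet_derivative\<close> by an explicit formula; the
  inductive closure proofs below go through this rule.\<close>

lemma Ck_on_SucI:
  assumes "\<And>x. x \<in> S \<Longrightarrow> (f has_derivative f' x) (at x)" "\<And>v. Ck_on k S (\<lambda>x. f' x v)" "open S"
  shows "Ck_on (Suc k) S f"
proof -
  have "Ck_on k S (dder f v)" for v
    using dder_eqI[OF assms(1)] by (intro Ck_on_cong[OF assms(3) _ assms(2)[of v]]) simp
  then show ?thesis
    using assms(1) by (auto simp: differentiable_def)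
qed

lemma Ck_on_has_derivative:
  "Ck_on (Suc k) S f \<Longrightarrow> x \<in> S \<Longrightarrow> (f has_derivative frechet_derivative f (at x)) (at x)"
  by (simp add: frechet_derivative_works[symmetric])

lemma Ck_on_dder: "Ck_on (Suc k) S f \<Longrightarrow> Ck_on k S (dder f v)"
  by simp

lemma Ck_on_SucD: "Ck_on (Suc k) S f \<Longrightarrow> Ck_on k S f"
proof (induction k arbitrary: f)
  case 0
  then show ?case
    by (simp add: continuous_at_imp_continuous_on differentiable_imp_continuous_within)
qed auto

lemma Ck_on_continuous: "Ck_on k S f \<Longrightarrow> continuous_on S f"
  by (induction k) (use Ck_on_SucD in auto)

lemma Ck_on_subset: "Ck_on k S f \<Longrightarrow> T \<subseteq> S \<Longrightarrow> Ck_on k T f"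
  by (induction k arbitrary: f) (auto intro: continuous_on_subset)

lemma Ck_on_bounded_linear:
  assumes "open S" "bounded_linear h" "Ck_on k S f"
  shows "Ck_on k S (\<lambda>x. h (f x))"
  using assms(3)
proof (induction k arbitrary: f)
  case 0
  then show ?case using assms(2) bounded_linear.continuous_on by auto
next
  case (Suc k)
  show ?case
  proof (rule Ck_on_SucI)
    show "((\<lambda>x. h (f x)) has_derivative (\<lambda>v. h (frechet_derivative f (at x) v))) (at x)" if "x \<in> S" for x
      using Ck_on_has_derivative[OF Suc.prems that] by (rule bounded_linear.has_derivative[OF assms(2)])
    show "Ck_on k S (\<lambda>x. h (frechet_derivative f (at x) v))" for v
      using Suc by auto
  qed (use assms(1) in auto)
qed

lemma Ck_on_add:
  assumes "open S" "Ck_on k S f" "Ck_on k S g"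
  shows "Ck_on k S (\<lambda>x. f x + g x)"
  using assms(2,3)
proof (induction k arbitrary: f g)
  case (Suc k)
  show ?case
  proof (rule Ck_on_SucI)
    show "((\<lambda>x. f x + g x) has_derivative (\<lambda>v. frechet_derivative f (at x) v + frechet_derivative g (at x) v)) (at x)"
      if "x \<in> S" for x
      by (intro has_derivative_add Ck_on_has_derivative[OF _ that]) (rule Suc.prems)+
    show "Ck_on k S (\<lambda>x. frechet_derivative f (at x) v + frechet_derivative g (at x) v)" for v
      using Suc by auto
  qed (use assms(1) in auto)
qed (auto intro: continuous_on_add)

text \<open>The product rule yields two terms of the same shape, one order lower, so the induction
  has to cover all pairs \<open>f\<close>, \<open>g\<close>.\<close>

lemma Ck_on_bilinear:
  assumes "open S" "bounded_bilinear h" "Ck_on k S f" "Ck_on k S g"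
  shows "Ck_on k S (\<lambda>x. h (f x) (g x))"
  using assms(3,4)
proof (induction k arbitrary: f g)
  case 0
  then show ?case using bounded_bilinear.continuous_on[OF assms(2)] by auto
next
  case (Suc k)
  show ?case
  proof (rule Ck_on_SucI)
    show "((\<lambda>x. h (f x) (g x)) has_derivative
       (\<lambda>v. h (f x) (frechet_derivative g (at x) v) + h (frechet_derivative f (at x) v) (g x))) (at x)"
      if "x \<in> S" for x
      by (intro bounded_bilinear.FDERIV[OF assms(2)] Ck_on_has_derivative[OF _ that]) (rule Suc.prems)+
    show "Ck_on k S (\<lambda>x. h (f x) (frechet_derivative g (at x) v) + h (frechet_derivative f (at x) v) (g x))" for v
      by (intro Ck_on_add Suc.IH assms(1) Ck_on_SucD[OF Suc.prems(1)] Ck_on_SucD[OF Suc.prems(2)]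
          Ck_on_dder[OF Suc.prems(1)] Ck_on_dder[OF Suc.prems(2)])
  qed (use assms(1) in auto)
qed

lemma Ck_on_diff:
  fixes f :: "'a::real_normed_vector \<Rightarrow> 'b::real_normed_vector"
  assumes "open S" "Ck_on k S f" "Ck_on k S g"
  shows "Ck_on k S (\<lambda>x. f x - g x)"
  using Ck_on_add[OF assms(1,2) Ck_on_bounded_linear[OF assms(1) bounded_linear_minus[OF bounded_linear_ident] assms(3)]]
  by simp

text \<open>Differentiation lowers the exponent by one, hence the induction over arbitrary
  \<open>a\<close>. The case \<open>a = - 1/2\<close> makes normalising a nowhere vanishing field
  smooth.\<close>

lemma Ck_on_powr:
  fixes r :: "'a::real_normed_vector \<Rightarrow> real"
  assumes "open S" "Ck_on k S r" "\<And>x. x \<in> S \<Longrightarrow> r x > 0"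
  shows "Ck_on k S (\<lambda>x. r x powr a)"
  using assms(2)
proof (induction k arbitrary: a)
  case 0
  then show ?case using assms(3) by (auto intro!: continuous_on_powr continuous_on_const dest!: assms(3))
next
  case (Suc k)
  show ?case
  proof (rule Ck_on_SucI)
    show "((\<lambda>x. r x powr a) has_derivative
       (\<lambda>v. a *\<^sub>R (r x powr (a - 1) * frechet_derivative r (at x) v))) (at x)" if "x \<in> S" for x
    proof -
      have "((\<lambda>y. y powr a) has_derivative (\<lambda>v. a * r x powr (a - 1) * v)) (at (r x))"
        using has_real_derivative_powr[OF assms(3)[OF that], of a] by (simp add: has_field_derivative_def)
      from has_derivative_compose[OF Ck_on_has_derivative[OF Suc.prems that] this]
      show ?thesis by (simp add: mult.assoc)
    qed
    show "Ck_on k S (\<lambda>x. a *\<^sub>R (r x powr (a - 1) * frechet_derivative r (at x) v))" for v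
      using Suc Ck_on_SucD
      by (intro Ck_on_bounded_linear[OF assms(1) bounded_linear_scaleR_right]
          Ck_on_bilinear[OF assms(1) bounded_bilinear_mult]) auto
  qed (use assms(1) in auto)
qed

section \<open>Symmetry of second derivatives\<close>

lemma second_difference_mean_value:
  fixes g :: "'a::real_normed_vector \<Rightarrow> real"
  assumes C2: "Ck_on (Suc (Suc 0)) S g" and "s > 0"
    and S: "\<And>\<sigma> \<tau>. 0 \<le> \<sigma> \<Longrightarrow> \<sigma> \<le> s \<Longrightarrow> 0 \<le> \<tau> \<Longrightarrow> \<tau> \<le> s \<Longrightarrow> x + \<tau> *\<^sub>R v + \<sigma> *\<^sub>R w \<in> S"
  obtains \<sigma> \<tau> where "0 < \<sigma>" "\<sigma> < s" "0 < \<tau>" "\<tau> < s"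
    "g (x + s *\<^sub>R v + s *\<^sub>R w) - g (x + s *\<^sub>R v) - g (x + s *\<^sub>R w) + g x
       = s * (s * dder (dder g v) w (x + \<tau> *\<^sub>R v + \<sigma> *\<^sub>R w))"
proof -
  have dg: "(g has_derivative frechet_derivative g (at y)) (at y)" if "y \<in> S" for y
    using C2 Ck_on_has_derivative that by blast
  have C1: "Ck_on (Suc 0) S (dder g v)" using C2 by (simp del: Ck_on.simps(1))
  have dg2: "(dder g v has_derivative frechet_derivative (dder g v) (at y)) (at y)" if "y \<in> S" for y
    using C1 Ck_on_has_derivative that by blast
  have lin: "frechet_derivative g (at y) (c *\<^sub>R u) = c * frechet_derivative g (at y) u" if "y \<in> S" for y c u
    using linear_scale[OF has_derivative_linear[OF dg[OF that]]] by simp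
  have lin2: "frechet_derivative (dder g v) (at y) (c *\<^sub>R u) = c * frechet_derivative (dder g v) (at y) u" if "y \<in> S" for y c u
    using linear_scale[OF has_derivative_linear[OF dg2[OF that]]] by simp
  \<comment> \<open>The second difference is \<open>\<phi> s - \<phi> 0\<close>. The mean value
    theorem is applied to \<phi> in the direction \<open>v\<close>, then to \<eta> in the direction
    \<open>w\<close>.\<close>
  define \<phi> where "\<phi> \<tau> = g (x + \<tau> *\<^sub>R v + s *\<^sub>R w) - g (x + \<tau> *\<^sub>R v)" for \<tau>
  have d\<phi>: "(\<phi> has_derivative (\<lambda>h. h * (dder g v (x + \<tau> *\<^sub>R v + s *\<^sub>R w) - dder g v (x + \<tau> *\<^sub>R v)))) (at \<tau>)"
    if "0 \<le> \<tau>" "\<tau> \<le> s" for \<tau>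
  proof -
    have m: "x + \<tau> *\<^sub>R v + s *\<^sub>R w \<in> S" "x + \<tau> *\<^sub>R v \<in> S" using S[of s \<tau>] S[of 0 \<tau>] that assms(2) by auto
    have "((\<lambda>\<tau>. x + \<tau> *\<^sub>R v + s *\<^sub>R w) has_derivative (\<lambda>h. h *\<^sub>R v)) (at \<tau>)"
         "((\<lambda>\<tau>. x + \<tau> *\<^sub>R v) has_derivative (\<lambda>h. h *\<^sub>R v)) (at \<tau>)"
      by (auto intro!: derivative_eq_intros)
    from has_derivative_diff[OF has_derivative_compose[OF this(1) dg[OF m(1)]] has_derivative_compose[OF this(2) dg[OF m(2)]]]
    show ?thesis by (simp add: \<phi>_def[abs_def] lin m right_diff_distrib)
  qed
  obtain \<tau> where \<tau>: "0 < \<tau>" "\<tau> < s"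
    "\<phi> s - \<phi> 0 = s * (dder g v (x + \<tau> *\<^sub>R v + s *\<^sub>R w) - dder g v (x + \<tau> *\<^sub>R v))"
    using mvt_simple[OF \<open>s > 0\<close> has_derivative_at_withinI[OF d\<phi>]] by auto
  define \<eta> where "\<eta> \<sigma> = dder g v (x + \<tau> *\<^sub>R v + \<sigma> *\<^sub>R w)" for \<sigma>
  have d\<eta>: "(\<eta> has_derivative (\<lambda>h. h * dder (dder g v) w (x + \<tau> *\<^sub>R v + \<sigma> *\<^sub>R w))) (at \<sigma>)"
    if "0 \<le> \<sigma>" "\<sigma> \<le> s" for \<sigma>
  proof -
    have m: "x + \<tau> *\<^sub>R v + \<sigma> *\<^sub>R w \<in> S" using S[of \<sigma> \<tau>] that \<tau> by auto
    have "((\<lambda>\<sigma>. x + \<tau> *\<^sub>R v + \<sigma> *\<^sub>R w) has_derivative (\<lambda>h. h *\<^sub>R w)) (at \<sigma>)"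
      by (auto intro!: derivative_eq_intros)
    from has_derivative_compose[OF this dg2[OF m]]
    show ?thesis by (simp add: \<eta>_def[abs_def] lin2 m)
  qed
  obtain \<sigma> where \<sigma>: "0 < \<sigma>" "\<sigma> < s" "\<eta> s - \<eta> 0 = s * dder (dder g v) w (x + \<tau> *\<^sub>R v + \<sigma> *\<^sub>R w)"
    using mvt_simple[OF \<open>s > 0\<close> has_derivative_at_withinI[OF d\<eta>]] by auto
  show thesis
    using that[of \<sigma> \<tau>] \<sigma> \<tau> by (simp add: \<phi>_def \<eta>_def)
qed

text \<open>The second difference is symmetric in \<open>v\<close> and \<open>w\<close>, so on
  arbitrarily small parallelograms both mixed derivatives share a value, possibly at different
  points; continuity then forces equality at \<open>x\<close>.\<close>

lemma dder_commute_real: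
  fixes g :: "'a::real_normed_vector \<Rightarrow> real"
  assumes "open S" "Ck_on (Suc (Suc 0)) S g" "x \<in> S"
  shows "dder (dder g v) w x = dder (dder g w) v x"
proof (rule ccontr)
  assume ne: "dder (dder g v) w x \<noteq> dder (dder g w) v x"
  define e where "e = \<bar>dder (dder g v) w x - dder (dder g w) v x\<bar> / 2"
  have e: "e > 0" using ne by (simp add: e_def)
  have c: "continuous (at x) (dder (dder g a) b)" for a b
    using assms by (simp add: continuous_on_eq_continuous_at)
  obtain d0 where d0: "d0 > 0" "ball x d0 \<subseteq> S" using assms open_contains_ball by blast
  obtain d1 where d1: "d1 > 0" "\<And>y. dist y x < d1 \<Longrightarrow> dist (dder (dder g v) w y) (dder (dder g v) w x) < e"
    using c[of v w] e unfolding continuous_at_eps_delta by blast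
  obtain d2 where d2: "d2 > 0" "\<And>y. dist y x < d2 \<Longrightarrow> dist (dder (dder g w) v y) (dder (dder g w) v x) < e"
    using c[of w v] e unfolding continuous_at_eps_delta by blast
  define d where "d = min d0 (min d1 d2)"
  have d: "d > 0" using d0 d1 d2 by (simp add: d_def)
  \<comment> \<open>The summand 1 keeps \<open>K\<close> positive even when \<open>v\<close> and
    \<open>w\<close> vanish. With \<open>s = d / (2 * K)\<close> the whole parallelogram stays
    within distance \<open>d\<close> of \<open>x\<close>.\<close>
  define K where "K = norm v + norm w + 1"
  have K: "K > 0" by (simp add: K_def add_nonneg_pos)
  define s where "s = d / (2 * K)"
  have s: "s > 0" using d K by (simp add: s_def)
  have close: "dist (x + \<tau> *\<^sub>R v + \<sigma> *\<^sub>R w) x < d" if "0 \<le> \<sigma>" "\<sigma> \<le> s" "0 \<le> \<tau>" "\<tau> \<le> s" for \<sigma> \<tau>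
  proof -
    have "norm (\<tau> *\<^sub>R v + \<sigma> *\<^sub>R w) \<le> \<tau> * norm v + \<sigma> * norm w"
      using norm_triangle_ineq[of "\<tau> *\<^sub>R v" "\<sigma> *\<^sub>R w"] that by simp
    also have "\<dots> \<le> s * norm v + s * norm w" using that by (intro add_mono mult_right_mono) auto
    also have "\<dots> \<le> s * K" using s by (simp add: K_def algebra_simps)
    also have "\<dots> < d" using d K by (simp add: s_def)
    finally show ?thesis by (simp add: dist_norm algebra_simps)
  qed
  have close': "dist (x + \<tau> *\<^sub>R w + \<sigma> *\<^sub>R v) x < d" if "0 \<le> \<sigma>" "\<sigma> \<le> s" "0 \<le> \<tau>" "\<tau> \<le> s" for \<sigma> \<tau>
    using close[of \<tau> \<sigma>] that by (simp add: add.assoc add.commute[of "\<tau> *\<^sub>R w"])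
  have inS: "y \<in> S" if "dist y x < d" for y
    using that d0 by (auto simp: d_def dist_commute subset_iff)
  obtain \<sigma> \<tau> where 1: "0 < \<sigma>" "\<sigma> < s" "0 < \<tau>" "\<tau> < s"
    "g (x + s *\<^sub>R v + s *\<^sub>R w) - g (x + s *\<^sub>R v) - g (x + s *\<^sub>R w) + g x
       = s * (s * dder (dder g v) w (x + \<tau> *\<^sub>R v + \<sigma> *\<^sub>R w))"
    using second_difference_mean_value[OF assms(2) s, of x v w] inS[OF close] by blast
  obtain \<sigma>' \<tau>' where 2: "0 < \<sigma>'" "\<sigma>' < s" "0 < \<tau>'" "\<tau>' < s"
    "g (x + s *\<^sub>R w + s *\<^sub>R v) - g (x + s *\<^sub>R w) - g (x + s *\<^sub>R v) + g x
       = s * (s * dder (dder g w) v (x + \<tau>' *\<^sub>R w + \<sigma>' *\<^sub>R v))"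
    using second_difference_mean_value[OF assms(2) s, of x w v] inS[OF close'] by blast
  have "dder (dder g v) w (x + \<tau> *\<^sub>R v + \<sigma> *\<^sub>R w) = dder (dder g w) v (x + \<sigma>' *\<^sub>R v + \<tau>' *\<^sub>R w)"
  proof -
    have "s * (s * dder (dder g v) w (x + \<tau> *\<^sub>R v + \<sigma> *\<^sub>R w)) =
          s * (s * dder (dder g w) v (x + \<tau>' *\<^sub>R w + \<sigma>' *\<^sub>R v))"
      unfolding 1(5)[symmetric] 2(5)[symmetric] by (simp add: algebra_simps)
    then show ?thesis using s by (simp add: algebra_simps)
  qed
  moreover have "dist (dder (dder g v) w (x + \<tau> *\<^sub>R v + \<sigma> *\<^sub>R w)) (dder (dder g v) w x) < e"
    using d1(2) close[of \<sigma> \<tau>] 1 by (simp add: d_def)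
  moreover have "dist (dder (dder g w) v (x + \<sigma>' *\<^sub>R v + \<tau>' *\<^sub>R w)) (dder (dder g w) v x) < e"
    using d2(2) close[of \<tau>' \<sigma>'] 2 by (simp add: d_def)
  \<comment> \<open>The common value would lie within \<open>e\<close> of two numbers that are
    \<open>2 * e\<close> apart.\<close>
  ultimately show False
    by (simp add: e_def dist_real_def abs_if split: if_splits)
qed

text \<open>Taking the inner product with every vector \<open>b\<close> reduces this to real-valued
  maps.\<close>

lemma dder_commute:
  fixes g :: "'a::real_normed_vector \<Rightarrow> 'b::real_inner"
  assumes "open S" "Ck_on (Suc (Suc 0)) S g" "x \<in> S"
  shows "dder (dder g v) w x = dder (dder g w) v x"
proof -
  have *: "dder (dder (\<lambda>x. g x \<bullet> b) v) w x = dder (dder g v) w x \<bullet> b" for b v w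
  proof -
    have 1: "frechet_derivative (\<lambda>x. g x \<bullet> b) (at y) = (\<lambda>v. dder g v y \<bullet> b)" if "y \<in> S" for y
      using Ck_on_has_derivative[OF assms(2) that]
      by (intro frechet_derivative_at[symmetric]) (auto intro!: derivative_eq_intros)
    have "Ck_on (Suc 0) S (dder g v)" using assms(2) by (simp del: Ck_on.simps(1))
    then have "((\<lambda>y. dder g v y \<bullet> b) has_derivative (\<lambda>w. dder (dder g v) w x \<bullet> b)) (at x)"
      by (intro has_derivative_inner_left Ck_on_has_derivative[OF _ assms(3)])
    then have "((\<lambda>y. dder (\<lambda>x. g x \<bullet> b) v y) has_derivative (\<lambda>w. dder (dder g v) w x \<bullet> b)) (at x)"
      by (rule has_derivative_transform_within_open[OF _ assms(1,3)]) (simp add: 1)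
    from frechet_derivative_at[OF this] show ?thesis by metis
  qed
  have "Ck_on (Suc (Suc 0)) S (\<lambda>x. g x \<bullet> b)" for b
    using Ck_on_bounded_linear[OF assms(1) bounded_linear_inner_left assms(2)] .
  then have "dder (dder g v) w x \<bullet> b = dder (dder g w) v x \<bullet> b" for b
    using dder_commute_real[OF assms(1) _ assms(3)] * by metis
  then show ?thesis using inner_eq_zero_iff[of "dder (dder g v) w x - dder (dder g w) v x"]
    by (simp add: inner_diff_left del: inner_eq_zero_iff)
qed

section \<open>Local injectivity of immersions\<close>

lemma immersion_locally_injective:
  fixes f :: "'a::euclidean_space \<Rightarrow> 'b::euclidean_space"
  assumes "open S" "Ck_on (Suc 0) S f" "a \<in> S" "inj (frechet_derivative f (at a))"
  obtains r where "r > 0" "ball a r \<subseteq> S" "inj_on f (ball a r)"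
proof -
  define D where "D x = frechet_derivative f (at x)" for x
  have D: "(f has_derivative D x) (at x)" if "x \<in> S" for x
    unfolding D_def using Ck_on_has_derivative[OF assms(2) that] .
  obtain g' where g': "linear g'" "g' \<circ> D a = id"
    using linear_injective_left_inverse[of "D a"] has_derivative_linear[OF D[OF assms(3)]] assms(4)
    by (auto simp: D_def)
  have cont: "continuous (at a) (\<lambda>x. D x b)" for b
    using assms(1-3) by (simp add: continuous_on_eq_continuous_at D_def)
  \<comment> \<open>\<open>Ck_on\<close> gives continuity of each directional derivative only; in
    finite dimension the sum of the deviations over a basis bounds the operator norm.\<close>
  have "\<exists>d>0. \<forall>x. dist a x < d \<longrightarrow> onorm (\<lambda>v. D x v - D a v) < e" if e: "e > 0" for e
  proof -
    have "((\<lambda>x. \<Sum>b\<in>Basis. norm (D x b - D a b)) \<longlongrightarrow> (\<Sum>b\<in>(Basis::'a set). norm (D a b - D a b))) (at a)"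
      using cont by (intro tendsto_intros) (auto simp: continuous_at)
    then have "eventually (\<lambda>x. (\<Sum>b\<in>Basis. norm (D x b - D a b)) < e) (at a)"
      using e by (intro order_tendstoD(2)[where y="\<Sum>b\<in>(Basis::'a set). norm (D a b - D a b)"]) auto
    moreover have "eventually (\<lambda>x. x \<in> S) (at a)"
      using assms(1,3) by (simp add: eventually_at_in_open')
    ultimately have "eventually (\<lambda>x. (\<Sum>b\<in>Basis. norm (D x b - D a b)) < e \<and> x \<in> S) (at a)"
      by (rule eventually_conj)
    then obtain d where d: "d > 0" "\<And>x. x \<noteq> a \<Longrightarrow> dist x a < d \<Longrightarrow> (\<Sum>b\<in>Basis. norm (D x b - D a b)) < e \<and> x \<in> S"
      unfolding eventually_at by auto
    have "onorm (\<lambda>v. D x v - D a v) < e" if "dist a x < d" for x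
    proof (cases "x = a")
      case True
      then show ?thesis using e by (simp add: onorm_zero)
    next
      case False
      then have x: "(\<Sum>b\<in>Basis. norm (D x b - D a b)) < e" "x \<in> S"
        using d(2)[of x] that by (auto simp: dist_commute)
      have bl: "bounded_linear (\<lambda>v. D x v - D a v)"
        using D x(2) assms(3) by (intro bounded_linear_sub has_derivative_bounded_linear) auto
      have "norm (D x v - D a v) \<le> (\<Sum>b\<in>Basis. norm (D x b - D a b)) * norm v" for v
      proof -
        have "D x v - D a v = (\<Sum>b\<in>Basis. (v \<bullet> b) *\<^sub>R (D x b - D a b))"
          using linear_sum[OF bounded_linear.linear[OF bl], of "\<lambda>b. (v \<bullet> b) *\<^sub>R b" Basis]
            linear_scale[OF bounded_linear.linear[OF bl]]
          by (simp add: euclidean_representation)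
        also have "norm \<dots> \<le> (\<Sum>b\<in>Basis. norm ((v \<bullet> b) *\<^sub>R (D x b - D a b)))" by (rule norm_sum)
        also have "\<dots> \<le> (\<Sum>b\<in>Basis. norm (D x b - D a b) * norm v)"
          by (intro sum_mono) (simp add: Basis_le_norm mult.commute[of _ "norm v"] mult_right_mono)
        finally show ?thesis by (simp add: sum_distrib_right)
      qed
      then have "onorm (\<lambda>v. D x v - D a v) \<le> (\<Sum>b\<in>Basis. norm (D x b - D a b))"
        by (intro onorm_bound sum_nonneg) auto
      then show ?thesis using x by simp
    qed
    then show ?thesis using d(1) by blast
  qed
  then show thesis
    using has_derivative_locally_injective[OF assms(3,1) linear_conv_bounded_linear[THEN iffD1, OF g'(1)] g'(2) D] that
    by metis
qed

section \<open>Quaternions and the Maurer--Cartan form\<close>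

lemma vector_4:
  "(vector [x, y, z, w] :: ('a::zero) ^ 4)$1 = x"
  "(vector [x, y, z, w] :: ('a::zero) ^ 4)$2 = y"
  "(vector [x, y, z, w] :: ('a::zero) ^ 4)$3 = z"
  "(vector [x, y, z, w] :: ('a::zero) ^ 4)$4 = w"
  unfolding vector_def by simp_all

lemma qmult_nth [simp]:
  "(x \<star> y)$1 = x$1 * y$1 - x$2 * y$2 - x$3 * y$3 - x$4 * y$4"
  "(x \<star> y)$2 = x$1 * y$2 + x$2 * y$1 + x$3 * y$4 - x$4 * y$3"
  "(x \<star> y)$3 = x$1 * y$3 - x$2 * y$4 + x$3 * y$1 + x$4 * y$2"
  "(x \<star> y)$4 = x$1 * y$4 + x$2 * y$3 - x$3 * y$2 + x$4 * y$1"
  by (simp_all add: qmult_def vector_4)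

lemma qcnj_nth [simp]:
  "qcnj x$1 = x$1" "qcnj x$2 = - x$2" "qcnj x$3 = - x$3" "qcnj x$4 = - x$4"
  by (simp_all add: qcnj_def vector_4)

lemma qunit_nth [simp]:
  "qone$1 = 1" "qone$2 = 0" "qone$3 = 0" "qone$4 = 0"
  "qi$1 = 0" "qi$2 = 1" "qi$3 = 0" "qi$4 = 0"
  "qj$1 = 0" "qj$2 = 0" "qj$3 = 1" "qj$4 = 0"
  "qk$1 = 0" "qk$2 = 0" "qk$3 = 0" "qk$4 = 1"
  by (simp_all add: qone_def qi_def qj_def qk_def vector_4)

lemma quat_eq_iff: "(x :: quat) = y \<longleftrightarrow> x$1 = y$1 \<and> x$2 = y$2 \<and> x$3 = y$3 \<and> x$4 = y$4"
  by (simp add: vec_eq_iff forall_4)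

lemma inner_quat: "(x :: quat) \<bullet> y = x$1 * y$1 + x$2 * y$2 + x$3 * y$3 + x$4 * y$4"
  by (simp add: inner_vec_def sum_4)

lemma qmult_assoc: "x \<star> y \<star> z = x \<star> (y \<star> z)"
  by (simp add: quat_eq_iff algebra_simps)

lemma qmult_qone [simp]: "x \<star> qone = x" "qone \<star> x = x"
  by (simp_all add: quat_eq_iff)

lemma bounded_bilinear_qmult: "bounded_bilinear (\<star>)"
proof -
  have "bilinear (\<star>)"
    by (auto simp: bilinear_def quat_eq_iff algebra_simps intro!: linearI)
  then show ?thesis by (simp add: bilinear_conv_bounded_bilinear)
qed

lemmas qmult_linear_simps =
  bounded_bilinear.add_left[OF bounded_bilinear_qmult] bounded_bilinear.add_right[OF bounded_bilinear_qmult]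
  bounded_bilinear.diff_left[OF bounded_bilinear_qmult] bounded_bilinear.diff_right[OF bounded_bilinear_qmult]
  bounded_bilinear.scaleR_left[OF bounded_bilinear_qmult] bounded_bilinear.scaleR_right[OF bounded_bilinear_qmult]
  bounded_bilinear.minus_left[OF bounded_bilinear_qmult] bounded_bilinear.minus_right[OF bounded_bilinear_qmult]

lemma bounded_linear_qcnj: "bounded_linear qcnj"
  by (intro linear_conv_bounded_linear[THEN iffD1] linearI) (simp_all add: quat_eq_iff)

lemma qcnj_qmult: "qcnj (x \<star> y) = qcnj y \<star> qcnj x"
  by (simp add: quat_eq_iff algebra_simps)

lemma qcnj_qcnj [simp]: "qcnj (qcnj x) = x"
  by (simp add: quat_eq_iff)

lemma norm_qcnj [simp]: "norm (qcnj x) = norm x"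
  by (simp add: norm_eq_sqrt_inner inner_quat)

text \<open>Euler's four-square identity.\<close>

lemma norm_qmult: "norm (x \<star> y) = norm x * norm y"
  unfolding norm_eq_sqrt_inner inner_quat real_sqrt_mult[symmetric] qmult_nth
  by (rule arg_cong[of _ _ sqrt]) algebra

lemma norm_eq_1_quat: "norm x = 1 \<longleftrightarrow> x$1 * x$1 + x$2 * x$2 + x$3 * x$3 + x$4 * x$4 = 1" for x :: quat
  by (simp add: norm_eq_1 inner_quat)

lemma qcnj_cancel [simp]:
  assumes "norm x = 1"
  shows "qcnj x \<star> x = qone" "x \<star> qcnj x = qone" "qcnj x \<star> (x \<star> y) = y" "x \<star> (qcnj x \<star> y) = y"
proof -
  show 1: "qcnj x \<star> x = qone" "x \<star> qcnj x = qone"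
    using assms by (simp_all add: quat_eq_iff norm_eq_1_quat)
  show "qcnj x \<star> (x \<star> y) = y" "x \<star> (qcnj x \<star> y) = y"
    by (simp_all add: 1 qmult_assoc[symmetric])
qed

text \<open>Identifies Im H with \<open>real ^ 3\<close>; the commutator of imaginary quaternions
  becomes twice \<open>cross3\<close>.\<close>

definition qim :: "quat \<Rightarrow> real ^ 3" where "qim x = vector [x$2, x$3, x$4]"
definition imq :: "real ^ 3 \<Rightarrow> quat" where "imq v = vector [0, v$1, v$2, v$3]"

lemma qim_nth [simp]: "qim x$1 = x$2" "qim x$2 = x$3" "qim x$3 = x$4"
  by (simp_all add: qim_def vector_3)

lemma imq_nth [simp]: "imq v$1 = 0" "imq v$2 = v$1" "imq v$3 = v$2" "imq v$4 = v$3"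
  by (simp_all add: imq_def vector_4)

lemma vec3_eq_iff: "(x :: real ^ 3) = y \<longleftrightarrow> x$1 = y$1 \<and> x$2 = y$2 \<and> x$3 = y$3"
  by (simp add: vec_eq_iff forall_3)

lemma bounded_linear_qim: "bounded_linear qim"
  by (intro linear_conv_bounded_linear[THEN iffD1] linearI) (simp_all add: vec3_eq_iff)

lemma bounded_linear_imq: "bounded_linear imq"
  by (intro linear_conv_bounded_linear[THEN iffD1] linearI) (simp_all add: quat_eq_iff)

lemma qim_imq [simp]: "qim (imq v) = v"
  by (simp add: vec3_eq_iff)

lemma imq_qim: "x \<in> Im_quat \<Longrightarrow> imq (qim x) = x"
  by (simp add: quat_eq_iff Im_quat_def)

lemma cross3_nth [simp]:
  "cross3 a b$1 = a$2 * b$3 - a$3 * b$2"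
  "cross3 a b$2 = a$3 * b$1 - a$1 * b$3"
  "cross3 a b$3 = a$1 * b$2 - a$2 * b$1"
  by (simp_all add: cross3_def vector_3)

lemma inner_vec3: "(x :: real ^ 3) \<bullet> y = x$1 * y$1 + x$2 * y$2 + x$3 * y$3"
  by (simp add: inner_vec_def sum_3)

lemma qcnj_imq: "qcnj (imq a) = - imq a"
  by (simp add: quat_eq_iff)

text \<open>Polarised form of the four-square identity.\<close>

lemma inner_qmult_left: "norm p = 1 \<Longrightarrow> (p \<star> x) \<bullet> (p \<star> y) = x \<bullet> y"
proof -
  assume "norm p = 1"
  then have 1: "p$1 * p$1 + p$2 * p$2 + p$3 * p$3 + p$4 * p$4 = 1" by (simp add: norm_eq_1_quat)
  have "(p \<star> x) \<bullet> (p \<star> y) = (p$1 * p$1 + p$2 * p$2 + p$3 * p$3 + p$4 * p$4) * (x \<bullet> y)"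
    unfolding inner_quat qmult_nth by algebra
  then show ?thesis by (simp add: 1)
qed

lemma inner_imq [simp]: "imq a \<bullet> imq b = a \<bullet> b"
  by (simp add: inner_quat inner_vec3)

text \<open>The Maurer--Cartan form of \<open>S\<^sup>3\<close> pulled back along \<open>p\<close> and evaluated at the constant field \<open>w\<close>.\<close>

definition mcform :: "('a::real_normed_vector \<Rightarrow> quat) \<Rightarrow> 'a \<Rightarrow> 'a \<Rightarrow> real ^ 3" where
  "mcform p w u = qim (qcnj (p u) \<star> frechet_derivative p (at u) w)"

text \<open>Used to turn orthogonality relations between frame fields into relations between their
  derivatives.\<close>

lemma inner_const_dder:
  fixes f g :: "'a::real_normed_vector \<Rightarrow> 'b::real_inner"
  assumes "open S" "u \<in> S" "Ck_on (Suc 0) S f" "Ck_on (Suc 0) S g" "\<And>u. u \<in> S \<Longrightarrow> f u \<bullet> g u = c"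
  shows "dder f v u \<bullet> g u + f u \<bullet> dder g v u = 0"
proof -
  have "((\<lambda>u. f u \<bullet> g u) has_derivative (\<lambda>v. f u \<bullet> dder g v u + dder f v u \<bullet> g u)) (at u)"
    using Ck_on_has_derivative[OF assms(3,2)] Ck_on_has_derivative[OF assms(4,2)]
    by (rule has_derivative_inner)
  moreover have "((\<lambda>u. f u \<bullet> g u) has_derivative (\<lambda>v. 0)) (at u)"
    by (rule has_derivative_transform_within_open[OF has_derivative_const[of c] assms(1,2)])
      (simp add: assms(5))
  ultimately have "(\<lambda>v. f u \<bullet> dder g v u + dder f v u \<bullet> g u) = (\<lambda>v. 0)"
    by (rule has_derivative_unique)
  then show ?thesis by (auto dest!: fun_cong[of _ _ v])
qed

text \<open>A map into the unit sphere moves orthogonally to itself, so \<open>qcnj (p u)\<close>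
  times the derivative has no real part and \<open>qim\<close> loses nothing.\<close>

lemma dder_eq_mcform:
  assumes "open S" "Ck_on (Suc 0) S p" "\<And>u. u \<in> S \<Longrightarrow> norm (p u) = 1" "u \<in> S"
  shows "dder p w u = p u \<star> imq (mcform p w u)"
proof -
  have "dder p w u \<bullet> p u + p u \<bullet> dder p w u = 0"
    using assms(3) by (intro inner_const_dder[OF assms(1,4,2,2), of 1]) (simp add: norm_eq_1)
  then have "(qcnj (p u) \<star> dder p w u)$1 = 0"
    by (simp add: inner_quat algebra_simps)
  then have "imq (mcform p w u) = qcnj (p u) \<star> dder p w u"
    unfolding mcform_def by (intro imq_qim) (simp add: Im_quat_def)
  then show ?thesis using assms by simp
qed

lemma Ck_on_mcform:
  assumes "open S" "Ck_on (Suc k) S p"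
  shows "Ck_on k S (mcform p w)"
  unfolding mcform_def[abs_def]
  by (intro Ck_on_bounded_linear[OF assms(1) bounded_linear_qim] Ck_on_bilinear[OF assms(1) bounded_bilinear_qmult]
      Ck_on_bounded_linear[OF assms(1) bounded_linear_qcnj] Ck_on_SucD[OF assms(2)] Ck_on_dder[OF assms(2)])

text \<open>The second derivatives of \<open>p\<close> cancel by symmetry; what remains is a
  commutator of imaginary quaternions, that is, twice a cross product.\<close>

lemma maurer_cartan:
  assumes S: "open S" and C: "Ck_on (Suc (Suc 0)) S p" and "\<And>u. u \<in> S \<Longrightarrow> norm (p u) = 1" and u: "u \<in> S"
  shows "dder (mcform p w) v u - dder (mcform p v) w u = - 2 *\<^sub>R cross3 (mcform p v u) (mcform p w u)"
proof -
  have C1: "Ck_on (Suc 0) S p" using C by (rule Ck_on_SucD)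
  have dp: "dder p w u = p u \<star> imq (mcform p w u)" for w
    using assms(3) by (intro dder_eq_mcform[OF S C1 _ u])
  have d: "dder (mcform p w) v u = qim (qcnj (p u) \<star> dder (dder p w) v u + qcnj (dder p v u) \<star> dder p w u)" for v w
  proof -
    have "(mcform p w has_derivative
      (\<lambda>v. qim (qcnj (p u) \<star> dder (dder p w) v u + qcnj (dder p v u) \<star> dder p w u))) (at u)"
      unfolding mcform_def[abs_def]
      by (intro bounded_linear.has_derivative[OF bounded_linear_qim] bounded_bilinear.FDERIV[OF bounded_bilinear_qmult]
          bounded_linear.has_derivative[OF bounded_linear_qcnj] Ck_on_has_derivative[OF C1 u]
          Ck_on_has_derivative[OF Ck_on_dder[OF C] u])
    then show ?thesis by (rule dder_eqI)
  qed
  have e: "qcnj (dder p v u) \<star> dder p w u = - (imq (mcform p v u) \<star> imq (mcform p w u))" for v w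
    using assms(3)[OF u] unfolding dp
    by (simp add: qcnj_qmult qmult_assoc qcnj_imq qmult_linear_simps)
  have "dder (mcform p w) v u - dder (mcform p v) w u
      = qim (imq (mcform p w u) \<star> imq (mcform p v u) - imq (mcform p v u) \<star> imq (mcform p w u))"
    unfolding d e dder_commute[OF S C u, of v w] by (simp add: vec3_eq_iff)
  then show ?thesis by (simp add: vec3_eq_iff)
qed

text \<open>The derivative of \<open>p \<xi> p^-1\<close> is
  \<open>p (d\<xi> + [\<alpha>, \<xi>]) p^-1\<close>, where \<alpha> is the Maurer-Cartan form, and
  the assumed \<open>d\<xi>\<close> is exactly minus this commutator.\<close>

lemma conjugate_constant:
  assumes S: "open S" "connected S" and p: "Ck_on (Suc 0) S p" "\<And>u. u \<in> S \<Longrightarrow> norm (p u) = 1"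
    and \<xi>: "Ck_on (Suc 0) S \<xi>"
    and d\<xi>: "\<And>u v. u \<in> S \<Longrightarrow> dder \<xi> v u = - 2 *\<^sub>R cross3 (mcform p v u) (\<xi> u)"
    and u: "u \<in> S" "u' \<in> S"
  shows "p u \<star> imq (\<xi> u) \<star> qcnj (p u) = p u' \<star> imq (\<xi> u') \<star> qcnj (p u')"
proof (rule has_derivative_zero_unique_connected[OF S _ u])
  fix x assume x: "x \<in> S"
  have "((\<lambda>u. p u \<star> imq (\<xi> u) \<star> qcnj (p u)) has_derivative
     (\<lambda>v. p x \<star> imq (\<xi> x) \<star> qcnj (dder p v x) + (p x \<star> imq (dder \<xi> v x) + dder p v x \<star> imq (\<xi> x)) \<star> qcnj (p x))) (at x)"
    by (intro bounded_bilinear.FDERIV[OF bounded_bilinear_qmult]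
          bounded_linear.has_derivative[OF bounded_linear_qcnj] bounded_linear.has_derivative[OF bounded_linear_imq]
          Ck_on_has_derivative[OF p(1) x] Ck_on_has_derivative[OF \<xi> x])
  moreover have dp: "dder p w x = p x \<star> imq (mcform p w x)" for w
    using p by (intro dder_eq_mcform[OF S(1) _ _ x])
  have "p x \<star> imq (\<xi> x) \<star> qcnj (dder p v x) + (p x \<star> imq (dder \<xi> v x) + dder p v x \<star> imq (\<xi> x)) \<star> qcnj (p x) = 0" for v
  proof -
    let ?a = "imq (mcform p v x)" and ?x = "imq (\<xi> x)"
    have "imq (dder \<xi> v x) = ?x \<star> ?a - ?a \<star> ?x"
      using d\<xi>[OF x] by (simp add: quat_eq_iff)
    then have "p x \<star> ?x \<star> qcnj (dder p v x) + (p x \<star> imq (dder \<xi> v x) + dder p v x \<star> ?x) \<star> qcnj (p x)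
      = p x \<star> (?x \<star> qcnj ?a + (?x \<star> ?a - ?a \<star> ?x) + ?a \<star> ?x) \<star> qcnj (p x)"
      unfolding dp by (simp add: qcnj_qmult qmult_assoc qmult_linear_simps)
    also have "\<dots> = 0"
      by (simp add: qcnj_imq qmult_linear_simps bounded_bilinear.zero_left[OF bounded_bilinear_qmult]
          bounded_bilinear.zero_right[OF bounded_bilinear_qmult])
    finally show ?thesis .
  qed
  ultimately show "((\<lambda>u. p u \<star> imq (\<xi> u) \<star> qcnj (p u)) has_derivative (\<lambda>v. 0)) (at x)"
    by simp
qed

section \<open>The adapted frame\<close>

lemma cross_frame:
  fixes e1 e2 :: "real ^ 3"
  assumes "e1 \<bullet> e1 = 1" "e2 \<bullet> e2 = 1" "e1 \<bullet> e2 = 0"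
  shows "cross3 e1 e2 \<bullet> cross3 e1 e2 = 1" "cross3 e1 e2 \<bullet> e1 = 0" "cross3 e1 e2 \<bullet> e2 = 0"
proof -
  show "cross3 e1 e2 \<bullet> e1 = 0" "cross3 e1 e2 \<bullet> e2 = 0"
    by (simp_all add: dot_cross_self inner_commute)
  have "cross3 e1 e2 \<bullet> cross3 e1 e2 = (e1 \<bullet> e1) * (e2 \<bullet> e2) - (e1 \<bullet> e2) * (e1 \<bullet> e2)"
    unfolding inner_vec3 cross3_nth by algebra
  then show "cross3 e1 e2 \<bullet> cross3 e1 e2 = 1" using assms by simp
qed

lemma frame_expansion:
  fixes e1 e2 :: "real ^ 3"
  assumes "e1 \<bullet> e1 = 1" "e2 \<bullet> e2 = 1" "e1 \<bullet> e2 = 0"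
  shows "z = (z \<bullet> e1) *\<^sub>R e1 + (z \<bullet> e2) *\<^sub>R e2 + (z \<bullet> cross3 e1 e2) *\<^sub>R cross3 e1 e2"
proof -
  define d where "d = z - ((z \<bullet> e1) *\<^sub>R e1 + (z \<bullet> e2) *\<^sub>R e2 + (z \<bullet> cross3 e1 e2) *\<^sub>R cross3 e1 e2)"
  note f = cross_frame[OF assms]
  have e21: "e2 \<bullet> e1 = 0" using assms(3) by (simp add: inner_commute)
  have d: "d \<bullet> e1 = 0" "d \<bullet> e2 = 0" "d \<bullet> cross3 e1 e2 = 0"
    using assms f e21 f(2,3)[unfolded inner_commute[of "cross3 e1 e2"]]
    by (simp_all add: d_def inner_diff_left inner_add_left)
  \<comment> \<open>Lagrange's identity for the remainder \<open>d\<close> and the third frame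
    vector: both terms on the right vanish, since the cross product expands into multiples of
    \<open>d \<bullet> e1\<close> and \<open>d \<bullet> e2\<close>.\<close>
  have "d \<bullet> d * (cross3 e1 e2 \<bullet> cross3 e1 e2)
    = (d \<bullet> cross3 e1 e2) * (d \<bullet> cross3 e1 e2) + cross3 d (cross3 e1 e2) \<bullet> cross3 d (cross3 e1 e2)"
    using norm_cross_dot[of d "cross3 e1 e2"]
    by (simp add: power_mult_distrib power2_norm_eq_inner) (simp add: power2_eq_square)
  also have "cross3 d (cross3 e1 e2) = (d \<bullet> e2) *\<^sub>R e1 - (d \<bullet> e1) *\<^sub>R e2"
    by (simp add: vec3_eq_iff inner_vec3 algebra_simps)
  finally have "d = 0" using d f(1) by simp
  then show ?thesis by (simp add: d_def)
qed

lemmas cross_bilinear = cross_mult_left cross_mult_right cross_add_left cross_add_right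
  Cross3.left_diff_distrib Cross3.right_diff_distrib

text \<open>The structure equations force the frame to be constant in the direction \<open>e1\<close>
  and to rotate about it: first \<open>X \<bullet> e3 = Y \<bullet> e3 = 0\<close> determines \<open>de3\<close>, then
  \<open>X \<bullet> e2 + Y \<bullet> e1 = 0\<close> shows that \<open>de1\<close> is a multiple of \<open>(\<theta>1 - \<theta>2) e2\<close>, and the symmetry of
  the second derivative of \<open>e1\<close> makes the multiple vanish.\<close>

lemma adapted_frame_derivative:
  fixes X Y :: "real ^ 3 \<Rightarrow> real ^ 3 \<Rightarrow> real ^ 3" and e1 e2 :: "real ^ 3 \<Rightarrow> real ^ 3"
  assumes S: "open S" "u \<in> S"
    and C: "Ck_on (Suc (Suc 0)) S e1" "Ck_on (Suc (Suc 0)) S e2" "\<And>w. Ck_on (Suc 0) S (X w)" "\<And>w. Ck_on (Suc 0) S (Y w)"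
    and on: "\<And>u. u \<in> S \<Longrightarrow> e1 u \<bullet> e1 u = 1" "\<And>u. u \<in> S \<Longrightarrow> e2 u \<bullet> e2 u = 1" "\<And>u. u \<in> S \<Longrightarrow> e1 u \<bullet> e2 u = 0"
    and X3: "\<And>u w. u \<in> S \<Longrightarrow> X w u \<bullet> cross3 (e1 u) (e2 u) = 0"
    and Y3: "\<And>u w. u \<in> S \<Longrightarrow> Y w u \<bullet> cross3 (e1 u) (e2 u) = 0"
    and XY: "\<And>u w. u \<in> S \<Longrightarrow> X w u \<bullet> e2 u + Y w u \<bullet> e1 u = 0"
    and dual: "\<And>u. u \<in> S \<Longrightarrow> \<exists>v1 v2 v3. X v1 u = e1 u \<and> Y v1 u = 0 \<and> X v2 u = 0 \<and> Y v2 u = e2 u \<and>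
        X v3 u = - e2 u \<and> Y v3 u = e1 u"
    and dX: "\<And>u v w. u \<in> S \<Longrightarrow> dder (X w) v u - dder (X v) w u
        = - 2 *\<^sub>R (cross3 (X v u) (X w u) + (1/3) *\<^sub>R cross3 (Y v u) (Y w u))"
    and dY: "\<And>u v w. u \<in> S \<Longrightarrow> dder (Y w) v u - dder (Y v) w u
        = - 2 *\<^sub>R (cross3 (X v u) (Y w u) + cross3 (Y v u) (X w u))"
  shows "dder e1 v u = 0"
    and "dder e2 v u = - (2 * (X v u \<bullet> e1 u) + (2/3) * (Y v u \<bullet> e2 u)) *\<^sub>R cross3 (e1 u) (e2 u)"
proof -
  define e3 where "e3 u = cross3 (e1 u) (e2 u)" for u
  have C3: "Ck_on (Suc (Suc 0)) S e3"
    unfolding e3_def[abs_def]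
    using bilinear_conv_bounded_bilinear[THEN iffD1, OF bilinear_cross]
    by (intro Ck_on_bilinear[OF S(1) _ C(1,2)])
  note C1 = C(1,2)[THEN Ck_on_SucD] C3[THEN Ck_on_SucD]
  have on3: "e3 u \<bullet> e3 u = 1" "e3 u \<bullet> e1 u = 0" "e3 u \<bullet> e2 u = 0" if "u \<in> S" for u
    using cross_frame[OF on[OF that]] by (simp_all add: e3_def)
  note X3 = X3[folded e3_def] and Y3 = Y3[folded e3_def]
  \<comment> \<open>The \<open>e2\<close>-component of \<open>de1\<close>; it is the only one left
    once \<open>de1\<close> is seen to have no \<open>e3\<close>-component.\<close>
  define \<omega> where "\<omega> v u = dder e1 v u \<bullet> e2 u" for v u
  have E: "dder e1 v u \<bullet> e1 u = 0" "dder e2 v u \<bullet> e2 u = 0" "dder e2 v u \<bullet> e1 u = - \<omega> v u"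
    "dder e3 v u \<bullet> e1 u = - (dder e1 v u \<bullet> e3 u)" "dder e3 v u \<bullet> e2 u = - (dder e2 v u \<bullet> e3 u)" if u: "u \<in> S" for u v
    using inner_const_dder[OF S(1) u C1(1,1) on(1), of v] inner_const_dder[OF S(1) u C1(2,2) on(2), of v]
      inner_const_dder[OF S(1) u C1(1,2) on(3), of v] inner_const_dder[OF S(1) u C1(3,1) on3(2), of v]
      inner_const_dder[OF S(1) u C1(3,2) on3(3), of v]
    by (simp_all add: \<omega>_def inner_commute)
  have expand: "z = (z \<bullet> e1 u) *\<^sub>R e1 u + (z \<bullet> e2 u) *\<^sub>R e2 u + (z \<bullet> e3 u) *\<^sub>R e3 u" if "u \<in> S" for u z
    unfolding e3_def by (rule frame_expansion[OF on[OF that]])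
  \<comment> \<open>With \<theta>1 = \<open>X \<bullet> e1\<close>, \<theta>2 =
    \<open>Y \<bullet> e2\<close>, \<theta>3 = \<open>Y \<bullet> e1\<close> the linear relations
    say X = \<theta>1 e1 - \<theta>3 e2 and Y = \<theta>3 e1 + \<theta>2 e2. All cross products
    among values of \<open>X\<close> and \<open>Y\<close> are therefore multiples of
    \<open>e3\<close>.\<close>
  have Xe: "X w u = (X w u \<bullet> e1 u) *\<^sub>R e1 u - (Y w u \<bullet> e1 u) *\<^sub>R e2 u" if "u \<in> S" for u w
    using expand[OF that, of "X w u"] X3[OF that] XY[OF that, of w] by (simp add: eq_neg_iff_add_eq_0[symmetric])
  have Ye: "Y w u = (Y w u \<bullet> e1 u) *\<^sub>R e1 u + (Y w u \<bullet> e2 u) *\<^sub>R e2 u" if "u \<in> S" for u w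
    using expand[OF that, of "Y w u"] Y3[OF that] by simp
  have cr: "cross3 (e1 u) (e2 u) = e3 u" "cross3 (e2 u) (e1 u) = - e3 u" for u
    using cross_skew[of "e2 u" "e1 u"] by (simp_all add: e3_def)
  have XX: "cross3 (X v u) (X w u) = ((Y v u \<bullet> e1 u) * (X w u \<bullet> e1 u) - (X v u \<bullet> e1 u) * (Y w u \<bullet> e1 u)) *\<^sub>R e3 u" if "u \<in> S" for u v w
    by (rule trans[OF arg_cong2[where f=cross3, OF Xe[OF that] Xe[OF that]]]) (simp add: cross_bilinear cr algebra_simps)
  have YY: "cross3 (Y v u) (Y w u) = ((Y v u \<bullet> e1 u) * (Y w u \<bullet> e2 u) - (Y v u \<bullet> e2 u) * (Y w u \<bullet> e1 u)) *\<^sub>R e3 u" if "u \<in> S" for u v w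
    by (rule trans[OF arg_cong2[where f=cross3, OF Ye[OF that] Ye[OF that]]]) (simp add: cross_bilinear cr algebra_simps)
  have XYc: "cross3 (X v u) (Y w u) = ((X v u \<bullet> e1 u) * (Y w u \<bullet> e2 u) + (Y v u \<bullet> e1 u) * (Y w u \<bullet> e1 u)) *\<^sub>R e3 u" if "u \<in> S" for u v w
    by (rule trans[OF arg_cong2[where f=cross3, OF Xe[OF that] Ye[OF that]]]) (simp add: cross_bilinear cr algebra_simps)
  have YXc: "cross3 (Y v u) (X w u) = - ((X w u \<bullet> e1 u) * (Y v u \<bullet> e2 u) + (Y w u \<bullet> e1 u) * (Y v u \<bullet> e1 u)) *\<^sub>R e3 u" if "u \<in> S" for u v w
    using XYc[OF that, of w v] cross_skew[of "Y v u" "X w u"] by (simp add: algebra_simps)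
  \<comment> \<open>The \<open>e3\<close>-component of the structure equation for \<open>X\<close>.
    As \<open>X \<bullet> e3\<close> vanishes identically, the derivative can be moved from
    \<open>X\<close> onto \<open>e3\<close>; \<open>II\<close> does the same for
    \<open>Y\<close>.\<close>
  have I: "X w u \<bullet> dder e3 v u - X v u \<bullet> dder e3 w u = 2 * (((Y v u \<bullet> e1 u) * (X w u \<bullet> e1 u) - (X v u \<bullet> e1 u) * (Y w u \<bullet> e1 u)) 
       + (1/3) * ((Y v u \<bullet> e1 u) * (Y w u \<bullet> e2 u) - (Y v u \<bullet> e2 u) * (Y w u \<bullet> e1 u)))" if u: "u \<in> S" for u v w
  proof -
    have "(dder (X w) v u - dder (X v) w u) \<bullet> e3 u = X v u \<bullet> dder e3 w u - X w u \<bullet> dder e3 v u"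
      using inner_const_dder[OF S(1) u C(3) C1(3) X3, of w v] inner_const_dder[OF S(1) u C(3) C1(3) X3, of v w]
      by (simp add: inner_diff_left)
    then show ?thesis unfolding dX[OF u] XX[OF u] YY[OF u] by (simp add: inner_add_left on3[OF u] algebra_simps)
  qed
  have II: "Y w u \<bullet> dder e3 v u - Y v u \<bullet> dder e3 w u = 2 * ((X v u \<bullet> e1 u) * (Y w u \<bullet> e2 u) - (X w u \<bullet> e1 u) * (Y v u \<bullet> e2 u))"
    if u: "u \<in> S" for u v w
  proof -
    have "(dder (Y w) v u - dder (Y v) w u) \<bullet> e3 u = Y v u \<bullet> dder e3 w u - Y w u \<bullet> dder e3 v u"
      using inner_const_dder[OF S(1) u C(4) C1(3) Y3, of w v] inner_const_dder[OF S(1) u C(4) C1(3) Y3, of v w]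
      by (simp add: inner_diff_left)
    then show ?thesis unfolding dY[OF u] XYc[OF u] YXc[OF u] by (simp add: inner_add_left on3[OF u] algebra_simps)
  qed
  \<comment> \<open>The vectors \<open>v1\<close>, \<open>v2\<close>, \<open>v3\<close> are dual to
    \<theta>1, \<theta>2, \<theta>3. Evaluating \<open>I\<close> and \<open>II\<close> on pairs of
    them gives enough values of \<open>de3\<close>; pairing \<open>v1\<close> or \<open>v2\<close>
    with a general \<open>v\<close> then gives both components.\<close>
  have E3: "dder e3 v u \<bullet> e1 u = 0" "dder e3 v u \<bullet> e2 u = 2 * (X v u \<bullet> e1 u) + (2/3) * (Y v u \<bullet> e2 u)" if u: "u \<in> S" for u v
  proof -
    obtain v1 v2 v3 where v: "X v1 u = e1 u" "Y v1 u = 0" "X v2 u = 0" "Y v2 u = e2 u" "X v3 u = - e2 u" "Y v3 u = e1 u"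
      using dual[OF u] by blast
    have e21: "e2 u \<bullet> e1 u = 0" using on(3)[OF u] by (simp add: inner_commute)
    have a2: "e1 u \<bullet> dder e3 v2 u = 0"
      using I[OF u, of v2 v1] v on[OF u] e21 by simp
    have b1: "e2 u \<bullet> dder e3 v1 u = 2"
      using II[OF u, of v2 v1] v on[OF u] e21 by simp
    have b2: "e2 u \<bullet> dder e3 v2 u = 2/3"
      using I[OF u, of v3 v2] v on[OF u] e21 by (simp add: inner_minus_left)
    have "e1 u \<bullet> dder e3 v1 u = 0"
      using II[OF u, of v3 v1] v on[OF u] e21 by simp
    then show "dder e3 v u \<bullet> e1 u = 0"
      using I[OF u, of v1 v] v on[OF u] b1 by (subst (asm) Xe[OF u, of v]) (simp add: inner_diff_left inner_diff_right inner_commute)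
    show "dder e3 v u \<bullet> e2 u = 2 * (X v u \<bullet> e1 u) + (2/3) * (Y v u \<bullet> e2 u)"
      using II[OF u, of v2 v] v on[OF u] a2 b2 by (subst (asm) Ye[OF u, of v]) (simp add: inner_add_left inner_add_right inner_commute)
  qed
  \<comment> \<open>The derivative of \<open>X \<bullet> e2 + Y \<bullet> e1 = 0\<close>,
    antisymmetrised in \<open>v1\<close> and \<open>v\<close>. The structure equations contribute
    nothing here, because their right-hand sides point along \<open>e3\<close>.\<close>
  have om: "\<omega> v u = \<omega> v1 u * (X v u \<bullet> e1 u - Y v u \<bullet> e2 u)" if u: "u \<in> S" and v1: "X v1 u = e1 u" "Y v1 u = 0" for u v v1
  proof -
    have r: "dder (X w) v u \<bullet> e2 u + X w u \<bullet> dder e2 v u + dder (Y w) v u \<bullet> e1 u + Y w u \<bullet> dder e1 v u = 0" for v w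
    proof -
      have "((\<lambda>u. X w u \<bullet> e2 u + Y w u \<bullet> e1 u) has_derivative
        (\<lambda>v. (X w u \<bullet> dder e2 v u + dder (X w) v u \<bullet> e2 u) + (Y w u \<bullet> dder e1 v u + dder (Y w) v u \<bullet> e1 u))) (at u)"
        by (intro has_derivative_add has_derivative_inner Ck_on_has_derivative[OF C1(1) u]
           Ck_on_has_derivative[OF C1(2) u] Ck_on_has_derivative[OF C(3) u] Ck_on_has_derivative[OF C(4) u])
      moreover have "((\<lambda>u. X w u \<bullet> e2 u + Y w u \<bullet> e1 u) has_derivative (\<lambda>v. 0)) (at u)"
        by (rule has_derivative_transform_within_open[OF has_derivative_const[of 0] S(1) u]) (simp add: XY)
      ultimately have "(\<lambda>v. (X w u \<bullet> dder e2 v u + dder (X w) v u \<bullet> e2 u) + (Y w u \<bullet> dder e1 v u + dder (Y w) v u \<bullet> e1 u)) = (\<lambda>v. 0)"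
        by (rule has_derivative_unique)
      from fun_cong[OF this, of v] show ?thesis by simp
    qed
    have s: "X w u \<bullet> dder e2 v u + Y w u \<bullet> dder e1 v u = \<omega> v u * (Y w u \<bullet> e2 u - X w u \<bullet> e1 u)" for v w
      apply (subst Xe[OF u, of w], subst (2) Ye[OF u, of w])
      using E[OF u, of v] by (simp add: \<omega>_def inner_add_left inner_diff_left inner_commute algebra_simps)
    have "(dder (X v1) v u - dder (X v) v1 u) \<bullet> e2 u = 0" "(dder (Y v1) v u - dder (Y v) v1 u) \<bullet> e1 u = 0"
      unfolding dX[OF u] XX[OF u] YY[OF u] dY[OF u] XYc[OF u] YXc[OF u]
      by (simp_all add: inner_add_left on3[OF u])
    then show ?thesis
      using r[of v1 v] r[of v v1] s[of v1 v] s[of v v1] on[OF u] v1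
      by (simp add: inner_diff_left inner_commute algebra_simps)
  qed
  have w0: "\<omega> v u = 0" if u: "u \<in> S" for u v
  proof -
    obtain v1 v2 where v: "X v1 u = e1 u" "Y v1 u = 0" "X v2 u = 0" "Y v2 u = e2 u"
      using dual[OF u] by blast
    have E1e: "dder e1 w u = \<omega> w u *\<^sub>R e2 u" for w
      using expand[OF u, of "dder e1 w u"] E[OF u, of w] E3[OF u, of w] by (simp add: \<omega>_def)
    \<comment> \<open>The derivative of \<open>de1 \<bullet> e3 = 0\<close>. Its first term is
      symmetric in \<open>v\<close> and \<open>w\<close>, hence so is the second.\<close>
    have "dder (dder e1 w) v u \<bullet> e3 u + dder e1 w u \<bullet> dder e3 v u = 0" for v w
    proof -
      have "dder e1 w u' \<bullet> e3 u' = 0" if "u' \<in> S" for u'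
        using E(4)[OF that, of w] E3(1)[OF that, of w] by simp
      from inner_const_dder[OF S(1) u Ck_on_dder[OF C(1)] C1(3) this] show ?thesis .
    qed
    then have "dder e1 v1 u \<bullet> dder e3 v2 u = dder e1 v2 u \<bullet> dder e3 v1 u"
      using dder_commute[OF S(1) C(1) u, of v1 v2] by (metis add_left_cancel)
    then have "\<omega> v1 u * (dder e3 v2 u \<bullet> e2 u) = \<omega> v2 u * (dder e3 v1 u \<bullet> e2 u)"
      by (simp add: E1e inner_commute)
    \<comment> \<open>By \<open>om\<close>, \<open>\<omega> v2 u = - \<omega> v1 u\<close>, and
      \<open>de3 \<bullet> e2\<close> has the values 2 and 2/3 at \<open>v1\<close> and
      \<open>v2\<close>; so the equation reads (2/3) x = - 2 x for x =
      \<open>\<omega> v1 u\<close>.\<close>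
    then have "\<omega> v1 u = 0"
      using om[OF u v(1,2), of v2] on[OF u] v by (simp add: E3[OF u])
    then show ?thesis using om[OF u v(1,2), of v] by simp
  qed
  show "dder e1 v u = 0"
    using expand[OF S(2), of "dder e1 v u"] E[OF S(2), of v] E3[OF S(2), of v] w0[OF S(2), of v] by (simp add: \<omega>_def)
  show "dder e2 v u = - (2 * (X v u \<bullet> e1 u) + (2/3) * (Y v u \<bullet> e2 u)) *\<^sub>R cross3 (e1 u) (e2 u)"
  proof -
    have "dder e2 v u \<bullet> e3 u = - (2 * (X v u \<bullet> e1 u) + (2/3) * (Y v u \<bullet> e2 u))"
      using E(5)[OF S(2), of v] E3(2)[OF S(2), of v] by simp
    then show ?thesis
      using expand[OF S(2), of "dder e2 v u"] E[OF S(2), of v] w0[OF S(2), of v] by (simp add: e3_def)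
  qed
qed

section \<open>Integration of the structure equations\<close>

lemma inner_qmult_right: "norm p = 1 \<Longrightarrow> (x \<star> p) \<bullet> (y \<star> p) = x \<bullet> y"
proof -
  assume "norm p = 1"
  then have 1: "p$1 * p$1 + p$2 * p$2 + p$3 * p$3 + p$4 * p$4 = 1" by (simp add: norm_eq_1_quat)
  have "(x \<star> p) \<bullet> (y \<star> p) = (p$1 * p$1 + p$2 * p$2 + p$3 * p$3 + p$4 * p$4) * (x \<bullet> y)"
    unfolding inner_quat qmult_nth by algebra
  then show ?thesis by (simp add: 1)
qed

text \<open>For d = 1 - m i one has m d = m + i = d i because m^2 = -1, so the normalised
  \<open>d\<close> conjugates i to m. It vanishes exactly for m = - i, where j serves
  instead.\<close>

lemma imaginary_unit_conjugate_qi: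
  assumes "norm m = 1" "m$1 = 0"
  obtains c where "norm c = 1" "m = c \<star> qi \<star> qcnj c"
proof (cases "m = - qi")
  case True
  have "norm qj = 1" by (simp add: norm_eq_1_quat)
  moreover have "m = qj \<star> qi \<star> qcnj qj" unfolding True by (simp add: quat_eq_iff)
  ultimately show thesis by (rule that)
next
  case False
  define d where "d = qone - m \<star> qi"
  have m: "m$2 * m$2 + m$3 * m$3 + m$4 * m$4 = 1" using assms by (simp add: norm_eq_1_quat)
  have mm: "m \<star> m = - qone" using m assms by (simp add: quat_eq_iff)
  have "d \<noteq> 0"
  proof
    assume "d = 0"
    then have "m \<star> (m \<star> qi) = m \<star> qone" by (simp add: d_def)
    then have "m = - qi" unfolding qmult_assoc[symmetric] mm by (simp add: qmult_linear_simps)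
    then show False using False by simp
  qed
  define c where "c = (1 / norm d) *\<^sub>R d"
  have nc: "norm c = 1" using \<open>d \<noteq> 0\<close> by (simp add: c_def)
  have "m \<star> d = d \<star> qi"
    using arg_cong[OF mm, of "\<lambda>x. x \<star> qi"] unfolding d_def
    by (simp add: qmult_linear_simps qmult_assoc[symmetric] mm) (simp add: quat_eq_iff)
  then have "m \<star> c = c \<star> qi" by (simp add: c_def qmult_linear_simps)
  then have "m \<star> (c \<star> qcnj c) = c \<star> qi \<star> qcnj c" by (simp add: qmult_assoc[symmetric])
  then show thesis using that[OF nc] nc by simp
qed

text \<open>On a contractible set x + i y has a continuous logarithm; modulus one makes it purely
  imaginary, and its imaginary part is the angle.\<close>

lemma angle_function:
  fixes x y :: "'a::real_normed_vector \<Rightarrow> real"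
  assumes "convex S" "continuous_on S x" "continuous_on S y" "\<And>u. u \<in> S \<Longrightarrow> x u * x u + y u * y u = 1"
  obtains \<phi> where "continuous_on S \<phi>" "\<And>u. u \<in> S \<Longrightarrow> x u = cos (\<phi> u)" "\<And>u. u \<in> S \<Longrightarrow> y u = sin (\<phi> u)"
proof -
  have ne: "Complex (x u) (y u) \<noteq> 0" if "u \<in> S" for u
    using assms(4)[OF that] by (auto simp: complex_eq_iff)
  have cont: "continuous_on S (\<lambda>u. Complex (x u) (y u))"
    unfolding Complex_eq using assms by (intro continuous_intros)
  obtain g where g: "continuous_on S g" "\<And>u. u \<in> S \<Longrightarrow> Complex (x u) (y u) = exp (g u)"
    by (rule continuous_logarithm_on_contractible[OF cont convex_imp_contractible[OF assms(1)] ne]) blast+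
  have "exp (Re (g u)) = 1" if "u \<in> S" for u
  proof -
    have "norm (Complex (x u) (y u)) = 1"
      using assms(4)[OF that] by (simp add: cmod_def power2_eq_square)
    then show ?thesis using g(2)[OF that] by (simp add: norm_exp_eq_Re)
  qed
  then have "x u = cos (Im (g u)) \<and> y u = sin (Im (g u))" if "u \<in> S" for u
    using g(2)[OF that] that by (auto simp: complex_eq_iff Re_exp Im_exp)
  moreover have "continuous_on S (\<lambda>u. Im (g u))" using g(1) by (intro continuous_intros)
  ultimately show thesis using that by blast
qed

text \<open>\<open>P2\<close> and the unit norm put \<open>P\<close> on the torus with squared radii
  1/4 and 3/4, and \<open>PQ\<close> passes this on to \<open>Q\<close>. Three angles
  \<open>a\<close>, \<open>b\<close>, \<open>a'\<close> are lifted; the remaining components of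
  \<open>PQ\<close> determine the fourth.\<close>

lemma torus_eq_model:
  fixes P Q :: "real ^ 3 \<Rightarrow> quat"
  assumes S: "convex S" and C: "continuous_on S P" "continuous_on S Q"
    and n: "\<And>u. u \<in> S \<Longrightarrow> norm (P u) = 1" "\<And>u. u \<in> S \<Longrightarrow> norm (Q u) = 1"
    and P2: "\<And>u. u \<in> S \<Longrightarrow> (qcnj (P u) \<star> qi \<star> P u)$2 = - 1 / 2"
    and PQ: "\<And>u. u \<in> S \<Longrightarrow> qcnj (P u) \<star> qi \<star> P u + qcnj (Q u) \<star> qi \<star> Q u = - qi"
  obtains h :: "real ^ 3 \<Rightarrow> real ^ 3" where "continuous_on S h"
    "\<And>u. u \<in> S \<Longrightarrow> (P u, Q u) = model ((1/2) *\<^sub>R qone) ((1/2) *\<^sub>R qone) (h u)"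
proof -
  have nP: "P u$1 * P u$1 + P u$2 * P u$2 = 1/4" "P u$3 * P u$3 + P u$4 * P u$4 = 3/4" if "u \<in> S" for u
    using P2[OF that] n(1)[OF that] by (simp_all add: norm_eq_1_quat)
  have nQ: "Q u$1 * Q u$1 + Q u$2 * Q u$2 = 1/4" if "u \<in> S" for u
    using P2[OF that] n(2)[OF that] arg_cong[OF PQ[OF that], of "\<lambda>x. x$2"] by (simp add: norm_eq_1_quat)
  have PQ': "P u$2 * P u$3 - P u$1 * P u$4 + Q u$2 * Q u$3 - Q u$1 * Q u$4 = 0"
    "P u$1 * P u$3 + P u$2 * P u$4 + Q u$1 * Q u$3 + Q u$2 * Q u$4 = 0" if "u \<in> S" for u
  proof -
    have "2 * (P u$2 * P u$3 - P u$1 * P u$4 + Q u$2 * Q u$3 - Q u$1 * Q u$4) = 0"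
      using arg_cong[OF PQ[OF that], of "\<lambda>x. x$3"] by (simp add: algebra_simps)
    then show "P u$2 * P u$3 - P u$1 * P u$4 + Q u$2 * Q u$3 - Q u$1 * Q u$4 = 0" by simp
    have "2 * (P u$1 * P u$3 + P u$2 * P u$4 + Q u$1 * Q u$3 + Q u$2 * Q u$4) = 0"
      using arg_cong[OF PQ[OF that], of "\<lambda>x. x$4"] by (simp add: algebra_simps)
    then show "P u$1 * P u$3 + P u$2 * P u$4 + Q u$1 * Q u$3 + Q u$2 * Q u$4 = 0" by simp
  qed
  have cP: "continuous_on S (\<lambda>u. P u$i)" "continuous_on S (\<lambda>u. Q u$i)" for i
    using C by (auto intro!: continuous_intros)
  obtain a where a: "continuous_on S a" "\<And>u. u \<in> S \<Longrightarrow> 2 * P u$1 = cos (a u)" "\<And>u. u \<in> S \<Longrightarrow> 2 * P u$2 = sin (a u)"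
  proof (rule angle_function[OF S, of "\<lambda>u. 2 * P u$1" "\<lambda>u. 2 * P u$2"])
    show "2 * P u$1 * (2 * P u$1) + 2 * P u$2 * (2 * P u$2) = 1" if "u \<in> S" for u
      using nP(1)[OF that] by simp
  qed (use C in \<open>auto intro!: continuous_intros\<close>)
  obtain b where b: "continuous_on S b" "\<And>u. u \<in> S \<Longrightarrow> 2 / sqrt 3 * P u$4 = cos (b u)"
     "\<And>u. u \<in> S \<Longrightarrow> 2 / sqrt 3 * P u$3 = sin (b u)"
  proof (rule angle_function[OF S, of "\<lambda>u. 2 / sqrt 3 * P u$4" "\<lambda>u. 2 / sqrt 3 * P u$3"])
    show "2 / sqrt 3 * P u$4 * (2 / sqrt 3 * P u$4) + 2 / sqrt 3 * P u$3 * (2 / sqrt 3 * P u$3) = 1" if "u \<in> S" for u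
      using nP(2)[OF that] by (simp add: field_simps)
  qed (use C in \<open>auto intro!: continuous_intros\<close>)
  obtain a' where a': "continuous_on S a'" "\<And>u. u \<in> S \<Longrightarrow> 2 * Q u$1 = cos (a' u)" "\<And>u. u \<in> S \<Longrightarrow> 2 * Q u$2 = sin (a' u)"
  proof (rule angle_function[OF S, of "\<lambda>u. 2 * Q u$1" "\<lambda>u. 2 * Q u$2"])
    show "2 * Q u$1 * (2 * Q u$1) + 2 * Q u$2 * (2 * Q u$2) = 1" if "u \<in> S" for u
      using nQ[OF that] by simp
  qed (use C in \<open>auto intro!: continuous_intros\<close>)
  \<comment> \<open>Solves the linear system given by three arguments of the model for its
    parameters. The fourth argument is then \<open>b - sqrt 2 * V = a + b - a'\<close>.\<close>
  define U where "U u = (a u + a' u) / (2 * sqrt (3/2))" for u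
  define V where "V u = (a' u - a u) / sqrt 2" for u
  define T where "T u = (b u - U u / sqrt 6 - V u / sqrt 2) / sqrt (2/3)" for u
  define h where "h u = (vector [U u, V u, T u] :: real ^ 3)" for u
  have h: "h u$1 = U u" "h u$2 = V u" "h u$3 = T u" for u
    by (simp_all add: h_def)
  have UV: "sqrt (3/2) * U u = (a u + a' u) / 2" "1 / sqrt 2 * V u = (a' u - a u) / 2" "sqrt (2/3) * T u = b u - U u / sqrt 6 - V u / sqrt 2" for u
    by (simp_all add: U_def V_def T_def)
  have args: "sqrt (3/2) * U u - 1 / sqrt 2 * V u = a u" "sqrt (3/2) * U u + 1 / sqrt 2 * V u = a' u"
    "sqrt (2/3) * T u + 1 / sqrt 6 * U u + 1 / sqrt 2 * V u = b u"
    "sqrt (2/3) * T u + 1 / sqrt 6 * U u - 1 / sqrt 2 * V u = a u + b u - a' u" for u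
    using UV[of u] by (simp_all only: times_divide_eq_left mult_1_left) (simp_all add: field_simps)
  have "continuous_on S U" "continuous_on S V" unfolding U_def V_def using a b a' by (auto intro!: continuous_intros)
  then have "continuous_on S T" unfolding T_def using b by (auto intro!: continuous_intros)
  with \<open>continuous_on S U\<close> \<open>continuous_on S V\<close> have "continuous_on S h"
    unfolding continuous_on_componentwise[of S h] by (auto simp: Basis_vec_def inner_axis forall_3 h exhaust_3)
  moreover have "(P u, Q u) = model ((1/2) *\<^sub>R qone) ((1/2) *\<^sub>R qone) (h u)" if u: "u \<in> S" for u
  proof -
    have p: "P u$1 = cos (a u) / 2" "P u$2 = sin (a u) / 2" "P u$3 = sqrt 3 / 2 * sin (b u)" "P u$4 = sqrt 3 / 2 * cos (b u)"
      using a(2,3)[OF u] b(2,3)[OF u] by (auto simp: field_simps)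
    have q: "Q u$1 = cos (a' u) / 2" "Q u$2 = sin (a' u) / 2"
      using a'(2,3)[OF u] by auto
    have sc: "sin (a' u) * sin (a' u) + cos (a' u) * cos (a' u) = 1"
      using sin_cos_squared_add3[of "a' u"] by (simp only: add.commute)
    \<comment> \<open>Together with the next fact: \<open>Q u$4\<close> + i \<open>Q u$3\<close>
      times exp(i a') equals - (sqrt 3 / 2) exp(i (a + b)). Dividing by exp(i a') gives
      \<open>q4\<close> and \<open>q3\<close>.\<close>
    have 1: "cos (a' u) * Q u$4 - sin (a' u) * Q u$3 = - sqrt 3 / 2 * cos (a u + b u)"
      using PQ'(1)[OF u] unfolding p q cos_add by (simp add: algebra_simps)
    have 2: "cos (a' u) * Q u$3 + sin (a' u) * Q u$4 = - sqrt 3 / 2 * sin (a u + b u)"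
      using PQ'(2)[OF u] unfolding p q sin_add by (simp add: algebra_simps)
    have "Q u$4 = cos (a' u) * (cos (a' u) * Q u$4 - sin (a' u) * Q u$3) + sin (a' u) * (cos (a' u) * Q u$3 + sin (a' u) * Q u$4)"
      using sc by algebra
    then have q4: "Q u$4 = - sqrt 3 / 2 * cos (a u + b u - a' u)"
      unfolding 1 2 cos_diff[of "a u + b u"] by (simp add: algebra_simps)
    have "Q u$3 = cos (a' u) * (cos (a' u) * Q u$3 + sin (a' u) * Q u$4) - sin (a' u) * (cos (a' u) * Q u$4 - sin (a' u) * Q u$3)"
      using sc by algebra
    then have q3: "Q u$3 = - sqrt 3 / 2 * sin (a u + b u - a' u)"
      unfolding 1 2 sin_diff[of "a u + b u"] by (simp add: algebra_simps)
    show ?thesis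
      unfolding model_def model_p_def model_q_def h args
      by (simp add: quat_eq_iff p q q3 q4)
  qed
  ultimately show thesis by (rule that)
qed

text \<open>By \<open>adapted_frame_derivative\<close> and \<open>conjugate_constant\<close>,
  suitable combinations of \<open>e1\<close> and \<open>e2\<close> become constant after conjugation
  by \<open>p\<close> and \<open>q\<close>. Rotating these constants and \<open>e1\<close> to
  \<open>qi\<close> leads to the situation of \<open>torus_eq_model\<close>.\<close>

lemma adapted_frame_congruence:
  fixes p q :: "real ^ 3 \<Rightarrow> quat" and e1 e2 :: "real ^ 3 \<Rightarrow> real ^ 3"
  defines "X \<equiv> \<lambda>w u. (1/2) *\<^sub>R (mcform p w u + mcform q w u)"
    and "Y \<equiv> \<lambda>w u. (sqrt 3/2) *\<^sub>R (mcform p w u - mcform q w u)"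
  assumes S: "open S" "convex S" "S \<noteq> {}"
    and C: "Ck_on (Suc (Suc 0)) S e1" "Ck_on (Suc (Suc 0)) S e2" "Ck_on (Suc (Suc 0)) S p" "Ck_on (Suc (Suc 0)) S q"
    and n: "\<And>u. u \<in> S \<Longrightarrow> norm (p u) = 1" "\<And>u. u \<in> S \<Longrightarrow> norm (q u) = 1"
    and on: "\<And>u. u \<in> S \<Longrightarrow> e1 u \<bullet> e1 u = 1" "\<And>u. u \<in> S \<Longrightarrow> e2 u \<bullet> e2 u = 1" "\<And>u. u \<in> S \<Longrightarrow> e1 u \<bullet> e2 u = 0"
    and X3: "\<And>u w. u \<in> S \<Longrightarrow> X w u \<bullet> cross3 (e1 u) (e2 u) = 0"
    and Y3: "\<And>u w. u \<in> S \<Longrightarrow> Y w u \<bullet> cross3 (e1 u) (e2 u) = 0"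
    and XY: "\<And>u w. u \<in> S \<Longrightarrow> X w u \<bullet> e2 u + Y w u \<bullet> e1 u = 0"
    and dual: "\<And>u. u \<in> S \<Longrightarrow> \<exists>v1 v2 v3. X v1 u = e1 u \<and> Y v1 u = 0 \<and> X v2 u = 0 \<and> Y v2 u = e2 u \<and>
        X v3 u = - e2 u \<and> Y v3 u = e1 u"
  obtains a b c h where "norm a = 1" "norm b = 1" "norm c = 1" "continuous_on S h"
    "\<And>u. u \<in> S \<Longrightarrow> (p u, q u) = isom a b c (model ((1/2) *\<^sub>R qone) ((1/2) *\<^sub>R qone) (h u))"
proof -
  have CM: "Ck_on (Suc 0) S (mcform p w)" "Ck_on (Suc 0) S (mcform q w)" for w
    using Ck_on_mcform[OF S(1)] C(3,4) by blast+
  have CX: "Ck_on (Suc 0) S (X w)" "Ck_on (Suc 0) S (Y w)" for w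
    unfolding X_def Y_def
    by (intro Ck_on_bounded_linear[OF S(1) bounded_linear_scaleR_right] Ck_on_add Ck_on_diff S(1) CM)+
  have d: "dder (X w) v u = (1/2) *\<^sub>R (dder (mcform p w) v u + dder (mcform q w) v u)"
    "dder (Y w) v u = (sqrt 3/2) *\<^sub>R (dder (mcform p w) v u - dder (mcform q w) v u)" if u: "u \<in> S" for u v w
    unfolding X_def Y_def
    by (rule dder_eqI, intro bounded_linear.has_derivative[OF bounded_linear_scaleR_right] has_derivative_add
        has_derivative_diff Ck_on_has_derivative[OF CM(1) u] Ck_on_has_derivative[OF CM(2) u])+
  have mc: "dder (mcform p w) v u - dder (mcform p v) w u = - 2 *\<^sub>R cross3 (mcform p v u) (mcform p w u)"
    "dder (mcform q w) v u - dder (mcform q v) w u = - 2 *\<^sub>R cross3 (mcform q v u) (mcform q w u)"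
    if "u \<in> S" for u v w
    by (rule maurer_cartan[OF S(1) C(3) _ that] maurer_cartan[OF S(1) C(4) _ that], erule n)+
  \<comment> \<open>The Maurer-Cartan forms are X + Y / sqrt 3 and X - Y / sqrt 3. In the sum of the
    structure equations the mixed products cancel and \<open>Y\<close> with \<open>Y\<close> keeps
    the factor 1/3; in the difference only the mixed ones survive.\<close>
  have dX: "dder (X w) v u - dder (X v) w u
        = - 2 *\<^sub>R (cross3 (X v u) (X w u) + (1/3) *\<^sub>R cross3 (Y v u) (Y w u))" if u: "u \<in> S" for u v w
  proof -
    have "dder (X w) v u - dder (X v) w u = (1/2) *\<^sub>R ((dder (mcform p w) v u - dder (mcform p v) w u)
       + (dder (mcform q w) v u - dder (mcform q v) w u))"
      unfolding d[OF u] by (simp add: algebra_simps)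
    also have "\<dots> = - (cross3 (mcform p v u) (mcform p w u) + cross3 (mcform q v u) (mcform q w u))"
      unfolding mc[OF u] by (simp add: algebra_simps)
    also have "\<dots> = - 2 *\<^sub>R (cross3 (X v u) (X w u) + (1/3) *\<^sub>R cross3 (Y v u) (Y w u))"
      unfolding X_def Y_def by (simp add: cross_bilinear vec3_eq_iff field_simps)
    finally show ?thesis .
  qed
  have dY: "dder (Y w) v u - dder (Y v) w u
        = - 2 *\<^sub>R (cross3 (X v u) (Y w u) + cross3 (Y v u) (X w u))" if u: "u \<in> S" for u v w
  proof -
    have "dder (Y w) v u - dder (Y v) w u = (sqrt 3/2) *\<^sub>R ((dder (mcform p w) v u - dder (mcform p v) w u)
       - (dder (mcform q w) v u - dder (mcform q v) w u))"
      unfolding d[OF u] by (simp add: algebra_simps)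
    also have "\<dots> = - sqrt 3 *\<^sub>R (cross3 (mcform p v u) (mcform p w u) - cross3 (mcform q v u) (mcform q w u))"
      unfolding mc[OF u] by (simp add: algebra_simps)
    also have "\<dots> = - 2 *\<^sub>R (cross3 (X v u) (Y w u) + cross3 (Y v u) (X w u))"
      unfolding X_def Y_def by (simp add: cross_bilinear vec3_eq_iff field_simps)
    finally show ?thesis .
  qed
  have fd: "dder e1 v u = 0"
    "dder e2 v u = - (2 * (X v u \<bullet> e1 u) + (2/3) * (Y v u \<bullet> e2 u)) *\<^sub>R cross3 (e1 u) (e2 u)"
    if u: "u \<in> S" for u v
    by (rule adapted_frame_derivative[where X=X and Y=Y, OF S(1) u C(1,2) CX];
        erule on X3 Y3 XY dual dX dY)+
  have con: "connected S" using S(2) by (rule convex_connected)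
  obtain u0 where u0: "u0 \<in> S" using S(3) by blast
  have C1: "Ck_on (Suc 0) S e1" "Ck_on (Suc 0) S e2" "Ck_on (Suc 0) S p" "Ck_on (Suc 0) S q"
    using C by (blast intro: Ck_on_SucD)+
  have e1c: "e1 u = e1 u0" if u: "u \<in> S" for u
  proof (rule has_derivative_zero_unique_connected[OF S(1) con _ u u0])
    fix x assume x: "x \<in> S"
    have "frechet_derivative e1 (at x) = (\<lambda>v. 0)" using fd(1)[OF x] by blast
    then show "(e1 has_derivative (\<lambda>v. 0)) (at x)" using Ck_on_has_derivative[OF C1(1) x] by simp
  qed
  have frame: "mcform p v u = X v u + (1 / sqrt 3) *\<^sub>R Y v u" "mcform q v u = X v u - (1 / sqrt 3) *\<^sub>R Y v u" for v u
    unfolding X_def Y_def by (simp_all add: vec3_eq_iff field_simps)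
  \<comment> \<open>For \<sigma> = 1 and \<sigma> = -1 these are the unit vectors at 120 degrees
    from \<open>e1\<close> in the frame plane. With these coefficients the terms in
    \<open>Y v u \<bullet> e1\<close> cancel in the cross product below, as
    \<open>conjugate_constant\<close> requires: \<sigma> = 1 for \<open>p\<close>, \<sigma> = -1 for
    \<open>q\<close>.\<close>
  define \<xi> where "\<xi> \<sigma> u = (- 1/2) *\<^sub>R e1 u + (\<sigma> * sqrt 3 / 2) *\<^sub>R e2 u" for \<sigma> u
  have C\<xi>: "Ck_on (Suc 0) S (\<xi> \<sigma>)" for \<sigma>
    unfolding \<xi>_def by (intro Ck_on_add Ck_on_bounded_linear[OF S(1) bounded_linear_scaleR_right] S(1) C1)
  have d\<xi>: "dder (\<xi> \<sigma>) v u = - 2 *\<^sub>R cross3 (X v u + (\<sigma> / sqrt 3) *\<^sub>R Y v u) (\<xi> \<sigma> u)" if u: "u \<in> S" and \<sigma>: "\<sigma> * \<sigma> = 1" for \<sigma> v u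
  proof -
    have "dder (\<xi> \<sigma>) v u = (- 1/2) *\<^sub>R dder e1 v u + (\<sigma> * sqrt 3 / 2) *\<^sub>R dder e2 v u"
      unfolding \<xi>_def
      by (rule dder_eqI, intro bounded_linear.has_derivative[OF bounded_linear_scaleR_right] has_derivative_add
        Ck_on_has_derivative[OF C1(1) u] Ck_on_has_derivative[OF C1(2) u])
    also have "\<dots> = - (\<sigma> * (sqrt 3 * (X v u \<bullet> e1 u) + (1 / sqrt 3) * (Y v u \<bullet> e2 u))) *\<^sub>R cross3 (e1 u) (e2 u)"
      unfolding fd[OF u] by (simp add: field_simps)
    also have "\<dots> = - 2 *\<^sub>R cross3 (X v u + (\<sigma> / sqrt 3) *\<^sub>R Y v u) (\<xi> \<sigma> u)"
    proof -
      let ?x = "X v u \<bullet> e1 u" and ?y = "Y v u \<bullet> e2 u" and ?z = "Y v u \<bullet> e1 u" and ?c = "cross3 (e1 u) (e2 u)"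
      have x: "X v u = ?x *\<^sub>R e1 u - ?z *\<^sub>R e2 u"
        using frame_expansion[OF on[OF u], of "X v u"] X3[OF u] XY[OF u, of v] by (simp add: eq_neg_iff_add_eq_0[symmetric])
      have y: "Y v u = ?z *\<^sub>R e1 u + ?y *\<^sub>R e2 u"
        using frame_expansion[OF on[OF u], of "Y v u"] Y3[OF u] by simp
      have cr: "cross3 (e2 u) (e1 u) = - ?c" by (rule cross_skew)
      have "cross3 (X v u + (\<sigma> / sqrt 3) *\<^sub>R Y v u) (\<xi> \<sigma> u)
        = cross3 ((?x *\<^sub>R e1 u - ?z *\<^sub>R e2 u) + (\<sigma> / sqrt 3) *\<^sub>R (?z *\<^sub>R e1 u + ?y *\<^sub>R e2 u)) (\<xi> \<sigma> u)"
        using x y by presburger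
      also have "\<dots> = ((\<sigma> * sqrt 3 / 2) * ?x + (\<sigma> * \<sigma>) * ?z / 2 - ?z / 2 + \<sigma> / sqrt 3 * ?y / 2) *\<^sub>R ?c"
        unfolding \<xi>_def by (simp add: cross_bilinear cr algebra_simps)
      moreover have "- 2 * ((\<sigma> * sqrt 3 / 2) * ?x + 1 * ?z / 2 - ?z / 2 + \<sigma> / sqrt 3 * ?y / 2)
        = - (\<sigma> * (sqrt 3 * ?x + (1 / sqrt 3) * ?y))"
        by (simp add: field_simps)
      ultimately show ?thesis by (simp only: \<sigma> scaleR_scaleR)
    qed
    finally show ?thesis .
  qed
  have np: "p u \<star> imq (\<xi> 1 u) \<star> qcnj (p u) = p u0 \<star> imq (\<xi> 1 u0) \<star> qcnj (p u0)" if u: "u \<in> S" for u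
    using conjugate_constant[OF S(1) con C1(3) n(1) C\<xi>, of 1 u u0] d\<xi>[of _ 1] u u0 by (simp add: frame)
  have nq: "q u \<star> imq (\<xi> (-1) u) \<star> qcnj (q u) = q u0 \<star> imq (\<xi> (-1) u0) \<star> qcnj (q u0)" if u: "u \<in> S" for u
    using conjugate_constant[OF S(1) con C1(4) n(2) C\<xi>, of "-1" u u0] d\<xi>[of _ "-1"] u u0 by (simp add: frame)
  have n\<xi>: "norm (imq (\<xi> \<sigma> u0)) = 1" if "\<sigma> * \<sigma> = 1" for \<sigma>
  proof -
    have "\<xi> \<sigma> u0 \<bullet> \<xi> \<sigma> u0 = 1/4 + (\<sigma> * \<sigma>) * (3/4)"
      unfolding \<xi>_def using on[OF u0] by (simp add: inner_add_left inner_add_right inner_diff_left inner_diff_right inner_commute[of "e2 u0" "e1 u0"])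
    then show ?thesis using that by (simp add: norm_eq_1)
  qed
  have conj: "norm (x \<star> imq z \<star> qcnj x) = norm (imq z)" "(x \<star> imq z \<star> qcnj x)$1 = 0" if "norm x = 1" for x z
    using that by (simp add: norm_qmult) (simp add: algebra_simps)
  \<comment> \<open>The two constants and \<open>e1 u0\<close> are imaginary units, hence conjugates
    of i.\<close>
  obtain a where a: "norm a = 1" "p u0 \<star> imq (\<xi> 1 u0) \<star> qcnj (p u0) = a \<star> qi \<star> qcnj a"
    using imaginary_unit_conjugate_qi[of "p u0 \<star> imq (\<xi> 1 u0) \<star> qcnj (p u0)"] conj[OF n(1)[OF u0]] n\<xi>[of 1] by auto
  obtain b where b: "norm b = 1" "q u0 \<star> imq (\<xi> (-1) u0) \<star> qcnj (q u0) = b \<star> qi \<star> qcnj b"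
    using imaginary_unit_conjugate_qi[of "q u0 \<star> imq (\<xi> (-1) u0) \<star> qcnj (q u0)"] conj[OF n(2)[OF u0]] n\<xi>[of "-1"] by auto
  obtain c where c: "norm c = 1" "imq (e1 u0) = c \<star> qi \<star> qcnj c"
    using imaginary_unit_conjugate_qi[of "imq (e1 u0)"] on(1)[OF u0] by (auto simp: norm_eq_1)
  \<comment> \<open>Undoes the isometry \<open>isom a b c\<close>. By \<open>key\<close>,
    conjugating \<open>qi\<close> by \<open>P\<close> or \<open>Q\<close> gives \<xi> rotated by
    \<open>c\<close>.\<close>
  define P where "P u = qcnj a \<star> p u \<star> c" for u
  define Q where "Q u = qcnj b \<star> q u \<star> c" for u
  have key: "qcnj (qcnj a \<star> x \<star> c) \<star> qi \<star> (qcnj a \<star> x \<star> c) = qcnj c \<star> z \<star> c"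
    if "norm x = 1" "x \<star> z \<star> qcnj x = a \<star> qi \<star> qcnj a" for a x z
  proof -
    have "qcnj (qcnj a \<star> x \<star> c) \<star> qi \<star> (qcnj a \<star> x \<star> c) = qcnj c \<star> (qcnj x \<star> (a \<star> qi \<star> qcnj a) \<star> x) \<star> c"
      by (simp add: qcnj_qmult qmult_assoc)
    also have "qcnj x \<star> (a \<star> qi \<star> qcnj a) \<star> x = z"
      unfolding that(2)[symmetric] using that(1) by (simp add: qmult_assoc)
    finally show ?thesis .
  qed
  have ce1: "qcnj c \<star> imq (e1 u) \<star> c = qi" if u: "u \<in> S" for u
    unfolding e1c[OF u] c(2) using c(1) by (simp add: qmult_assoc)
  have Pe: "qcnj (P u) \<star> qi \<star> P u = (-1/2) *\<^sub>R qi + (sqrt 3 / 2) *\<^sub>R (qcnj c \<star> imq (e2 u) \<star> c)" if u: "u \<in> S" for u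
  proof -
    have "imq (\<xi> 1 u) = (-1/2) *\<^sub>R imq (e1 u) + (sqrt 3 / 2) *\<^sub>R imq (e2 u)"
      by (simp add: \<xi>_def quat_eq_iff)
    then show ?thesis
      unfolding P_def key[OF n(1)[OF u] np[OF u, unfolded a(2)]] unfolding ce1[OF u, symmetric] by (simp add: qmult_linear_simps)
  qed
  have Qe: "qcnj (Q u) \<star> qi \<star> Q u = (-1/2) *\<^sub>R qi - (sqrt 3 / 2) *\<^sub>R (qcnj c \<star> imq (e2 u) \<star> c)" if u: "u \<in> S" for u
  proof -
    have "imq (\<xi> (-1) u) = (-1/2) *\<^sub>R imq (e1 u) - (sqrt 3 / 2) *\<^sub>R imq (e2 u)"
      by (simp add: \<xi>_def quat_eq_iff)
    then show ?thesis
      unfolding Q_def key[OF n(2)[OF u] nq[OF u, unfolded b(2)]] unfolding ce1[OF u, symmetric] by (simp add: qmult_linear_simps)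
  qed
  \<comment> \<open>Conjugation by the unit \<open>c\<close> is orthogonal and takes
    \<open>e1\<close> to \<open>qi\<close>, so the rotated \<open>e2\<close> has no
    i-component.\<close>
  have e2: "(qcnj c \<star> imq (e2 u) \<star> c)$2 = 0" if u: "u \<in> S" for u
  proof -
    have "(qcnj c \<star> imq (e2 u) \<star> c) \<bullet> (qcnj c \<star> imq (e1 u) \<star> c) = 0"
      using c(1) on(3)[OF u] by (simp add: inner_qmult_left inner_qmult_right inner_commute)
    then show ?thesis unfolding ce1[OF u] by (simp only: inner_quat qunit_nth mult_zero_right mult_1_right add_0_left add_0_right)
  qed
  have nPQ: "norm (P u) = 1" "norm (Q u) = 1" if "u \<in> S" for u
    using a b c n[OF that] by (simp_all add: P_def Q_def norm_qmult)
  have cont: "continuous_on S P" "continuous_on S Q"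
    unfolding P_def Q_def using Ck_on_continuous[OF C1(3)] Ck_on_continuous[OF C1(4)]
    by (auto intro!: bounded_bilinear.continuous_on[OF bounded_bilinear_qmult] continuous_on_const)
  have P2: "(qcnj (P u) \<star> qi \<star> P u)$2 = - 1 / 2" if "u \<in> S" for u
    unfolding Pe[OF that] using e2[OF that] by (simp del: qmult_nth)
  \<comment> \<open>The rotated \<open>e2\<close> enters \<open>Pe\<close> and \<open>Qe\<close>
    with opposite signs and cancels.\<close>
  have PQ: "qcnj (P u) \<star> qi \<star> P u + qcnj (Q u) \<star> qi \<star> Q u = - qi" if "u \<in> S" for u
    unfolding Pe[OF that] Qe[OF that] by (simp add: scaleR_left.add[symmetric])
  obtain h where h: "continuous_on S h" "\<And>u. u \<in> S \<Longrightarrow> (P u, Q u) = model ((1/2) *\<^sub>R qone) ((1/2) *\<^sub>R qone) (h u)"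
    using torus_eq_model[OF S(2) cont nPQ P2 PQ] by blast
  have "(p u, q u) = isom a b c (model ((1/2) *\<^sub>R qone) ((1/2) *\<^sub>R qone) (h u))" if u: "u \<in> S" for u
    unfolding h(2)[OF u, symmetric] isom_def using a(1) b(1) c(1) by (simp add: P_def Q_def qmult_assoc)
  then show thesis using that[OF a(1) b(1) c(1) h(1)] by blast
qed

section \<open>Tangent spaces\<close>

text \<open>A substitute for the chain rule when the chart change is merely continuous. For a small
  step \<open>t\<close>, f (u + t w) is a value f' y; injectivity of \<open>L\<close> bounds the
  norm of y - u' by a multiple of \<open>t\<close>, so L ((y - u') / t) approximates
  \<open>D w\<close>, and the range of \<open>L\<close> is closed.\<close>

lemma derivative_range_subset:
  fixes f :: "'a::real_normed_vector \<Rightarrow> 'c::euclidean_space" and f' :: "'b::euclidean_space \<Rightarrow> 'c"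
  assumes D: "(f has_derivative D) (at u)" and L: "(f' has_derivative L) (at u')" "inj L" and eq: "f u = f' u'"
    and nbh: "\<And>e. e > 0 \<Longrightarrow> \<exists>d>0. \<forall>y. norm (y - u) < d \<longrightarrow> (\<exists>y'. norm (y' - u') < e \<and> f y = f' y')"
  shows "range D \<subseteq> range L"
proof safe
  fix w
  have linD: "linear D" and linL: "linear L" using D L(1) has_derivative_linear by blast+
  obtain B where B: "B > 0" "\<And>x. B * norm x \<le> norm (L x)"
    using linear_inj_bounded_below_pos[OF linL L(2)] by blast
  have "D w \<in> closure (range L)"
    unfolding closure_approachable
  proof (intro allI impI)
    fix e :: real
    assume e: "e > 0"
    define K where "K = 1 + (2 / B) * (norm (D w) + norm w + 1)"
    have K: "K > 0" using B(1) by (simp add: K_def add_pos_nonneg)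
    \<comment> \<open>The bound \<open>B / 2\<close> absorbs the error of \<open>f'\<close> into the
      lower bound for \<open>L\<close>, the bound 1 controls the increment of \<open>f\<close>, and
      the last one makes the final error at most \<open>e / 2\<close>.\<close>
    define \<epsilon> where "\<epsilon> = min (min 1 (B / 2)) (e / (2 * K * (norm w + 1)))"
    have nw: "norm w + 1 > 0" by (simp add: add_nonneg_pos)
    have \<epsilon>: "\<epsilon> > 0" "\<epsilon> \<le> 1" "\<epsilon> \<le> B / 2" "\<epsilon> \<le> e / (2 * K * (norm w + 1))"
    proof -
      show "\<epsilon> > 0" using e B(1) K nw by (simp add: \<epsilon>_def)
    qed (simp_all only: \<epsilon>_def min_le_iff_disj order_refl simp_thms)
    obtain d1 where d1: "d1 > 0" "\<And>y. norm (y - u) < d1 \<Longrightarrow> norm (f y - f u - D (y - u)) \<le> \<epsilon> * norm (y - u)"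
      using D \<epsilon>(1) unfolding has_derivative_at_alt by blast
    obtain d2 where d2: "d2 > 0" "\<And>y. norm (y - u') < d2 \<Longrightarrow> norm (f' y - f' u' - L (y - u')) \<le> \<epsilon> * norm (y - u')"
      using L(1) \<epsilon>(1) unfolding has_derivative_at_alt by blast
    obtain d3 where d3: "d3 > 0" "\<And>y. norm (y - u) < d3 \<Longrightarrow> \<exists>y'. norm (y' - u') < d2 \<and> f y = f' y'"
      using nbh[OF d2(1)] by blast
    define t where "t = min d1 d3 / (2 * (norm w + 1))"
    have t: "t > 0" using d1(1) d3(1) nw by (simp add: t_def)
    have tw: "norm (u + t *\<^sub>R w - u) < min d1 d3"
    proof -
      have "norm (u + t *\<^sub>R w - u) = t * norm w" using t by simp
      also have "\<dots> \<le> t * (norm w + 1)" using t by simp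
      also have "\<dots> = min d1 d3 / 2" proof -
        have "m / (2 * k) * k = m / 2" if "k > 0" for m k :: real using that by (simp add: field_simps)
        from this[OF nw] show ?thesis unfolding t_def .
      qed
      also have "\<dots> < min d1 d3" using d1(1) d3(1) by (auto simp: min_def)
      finally show ?thesis .
    qed
    then obtain y where y: "norm (y - u') < d2" "f (u + t *\<^sub>R w) = f' y"
      using d3(2)[of "u + t *\<^sub>R w"] by (auto simp del: norm_scaleR)
    have A: "norm (f' y - f' u' - t *\<^sub>R D w) \<le> \<epsilon> * (t * norm w)"
      using d1(2)[of "u + t *\<^sub>R w"] tw t y(2) eq linear_scale[OF linD] by simp
    have Bd: "norm (f' y - f' u' - L (y - u')) \<le> \<epsilon> * norm (y - u')"
      using d2(2)[OF y(1)] .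
    have "B * norm (y - u') \<le> norm (L (y - u'))" by (rule B(2))
    also have "\<dots> \<le> norm (f' y - f' u') + norm (f' y - f' u' - L (y - u'))"
      using norm_triangle_ineq4[of "f' y - f' u'" "f' y - f' u' - L (y - u')"] by simp
    also have "\<dots> \<le> norm (f' y - f' u') + (B / 2) * norm (y - u')"
      using Bd mult_right_mono[OF \<epsilon>(3) norm_ge_zero[of "y - u'"]] by linarith
    finally have "norm (y - u') \<le> (2 / B) * norm (f' y - f' u')"
      using B(1) by (simp add: field_simps)
    also have "norm (f' y - f' u') \<le> t * (norm (D w) + norm w + 1)"
    proof -
      have "norm (f' y - f' u') \<le> norm (t *\<^sub>R D w) + norm (f' y - f' u' - t *\<^sub>R D w)"
        using norm_triangle_ineq[of "t *\<^sub>R D w" "f' y - f' u' - t *\<^sub>R D w"] by simp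
      also have "\<dots> \<le> t * norm (D w) + 1 * (t * norm w)"
      proof -
        have "\<epsilon> * (t * norm w) \<le> 1 * (t * norm w)"
          using t by (intro mult_right_mono \<epsilon>(2)) simp
        moreover have "norm (t *\<^sub>R D w) = t * norm (D w)" using t by simp
        ultimately show ?thesis using A by linarith
      qed
      also have "\<dots> \<le> t * (norm (D w) + norm w + 1)" using t by (simp add: algebra_simps)
      finally show ?thesis .
    qed
    finally have yb: "norm (y - u') \<le> (2 / B) * (t * (norm (D w) + norm w + 1))"
      using B(1) by (simp add: divide_le_cancel)
    have "norm (L (y - u') - t *\<^sub>R D w) \<le> \<epsilon> * (t * norm w) + \<epsilon> * norm (y - u')"
      using norm_triangle_ineq4[of "f' y - f' u' - t *\<^sub>R D w" "f' y - f' u' - L (y - u')"] A Bd by simp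
    also have "\<dots> \<le> \<epsilon> * (t * norm w) + \<epsilon> * ((2 / B) * (t * (norm (D w) + norm w + 1)))"
      using mult_left_mono[OF yb, of \<epsilon>] \<epsilon>(1) by linarith
    also have "\<dots> \<le> \<epsilon> * (t * (norm w + 1)) * K"
    proof -
      have "norm w + (2 / B) * (norm (D w) + norm w + 1) \<le> (norm w + 1) * K"
      proof -
        define k where "k = (2 / B) * (norm (D w) + norm w + 1)"
        have "k \<ge> 0" using B(1) by (simp add: k_def)
        then have "norm w + k \<le> (norm w + 1) * (1 + k)" by (simp add: algebra_simps)
        then show ?thesis by (simp only: K_def k_def)
      qed
      from mult_left_mono[OF this, of "\<epsilon> * t"] show ?thesis
        using \<epsilon>(1) t by (simp add: algebra_simps)
    qed
    finally have "norm (L (y - u') - t *\<^sub>R D w) \<le> t * (\<epsilon> * (norm w + 1) * K)" by (simp add: algebra_simps)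
    moreover have "norm (L ((1 / t) *\<^sub>R (y - u')) - D w) = norm (L (y - u') - t *\<^sub>R D w) / t"
    proof -
      have "L ((1 / t) *\<^sub>R (y - u')) - D w = (1 / t) *\<^sub>R (L (y - u') - t *\<^sub>R D w)"
        unfolding linear_scale[OF linL] unfolding scaleR_diff_right using t by simp
      then show ?thesis using t by simp
    qed
    ultimately have "norm (L ((1 / t) *\<^sub>R (y - u')) - D w) \<le> \<epsilon> * (norm w + 1) * K"
      using t by (simp add: divide_le_eq mult.commute)
    also have "\<dots> \<le> e / 2"
    proof -
      have "0 < 2 * K * (norm w + 1)" using K nw by simp
      then have "\<epsilon> * (2 * K * (norm w + 1)) \<le> e" using \<epsilon>(4) by (simp only: pos_le_divide_eq)
      then show ?thesis by (simp add: algebra_simps)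
    qed
    also have "\<dots> < e" using e by simp
    finally show "\<exists>y\<in>range L. dist y (D w) < e" by (auto simp: dist_norm)
  qed
  moreover have "closed (range L)"
    by (intro closed_subspace linear_subspace_image[OF linL] subspace_UNIV)
  ultimately show "D w \<in> range L" by (simp add: closure_closed)
qed

section \<open>Charts and their tangent spaces\<close>

lemma param_openin_image:
  assumes "param N F U \<psi>" "open B" "B \<subseteq> U"
  shows "openin N (\<psi> ` B)"
proof -
  have "openin (subtopology N (\<psi> ` U)) (\<psi> ` B)"
    using assms homeomorphic_imp_open_map unfolding param_def open_map_def
    by (metis openin_open_eq)
  then show ?thesis using assms(1) openin_trans_full unfolding param_def by blast
qed

lemma param_open_preimage:
  assumes "param N F U \<psi>" "openin N W"
  shows "open {u \<in> U. \<psi> u \<in> W}"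
proof -
  have "continuous_map (top_of_set U) (subtopology N (\<psi> ` U)) \<psi>"
    using assms homeomorphic_imp_continuous_map unfolding param_def by blast
  then have "continuous_map (top_of_set U) N \<psi>"
    by (simp add: continuous_map_in_subtopology)
  from openin_continuous_map_preimage[OF this assms(2)] show ?thesis
    using assms(1) unfolding param_def by (auto simp: openin_open_eq)
qed

lemma param_differential:
  assumes "param N F U \<psi>" "u \<in> U"
  shows "(F \<circ> \<psi> has_derivative frechet_derivative (F \<circ> \<psi>) (at u)) (at u)"
  using assms Ck_on_has_derivative[of 0 U "F \<circ> \<psi>" u] unfolding param_def smooth_on_def by blast

text \<open>Charts are homeomorphisms onto open sets, so points near \<open>u\<close> have the same
  image as points near \<open>u'\<close>; this is the neighbourhood hypothesis of
  \<open>derivative_range_subset\<close>.\<close>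

lemma param_tangent_subset:
  assumes 1: "param N F U \<psi>" "u \<in> U" and 2: "param N F U' \<psi>'" "u' \<in> U'" and eq: "\<psi> u = \<psi>' u'"
  shows "range (frechet_derivative (F \<circ> \<psi>) (at u)) \<subseteq> range (frechet_derivative (F \<circ> \<psi>') (at u'))"
proof (rule derivative_range_subset[OF param_differential[OF 1] param_differential[OF 2]])
  show "inj (frechet_derivative (F \<circ> \<psi>') (at u'))" using 2 by (auto simp: param_def)
  show "(F \<circ> \<psi>) u = (F \<circ> \<psi>') u'" using eq by simp
  fix e :: real
  assume e: "e > 0"
  let ?B = "ball u' e \<inter> U'"
  have "openin N (\<psi>' ` ?B)" using 2 by (intro param_openin_image[OF 2(1)]) (auto simp: param_def)
  then have "open {y \<in> U. \<psi> y \<in> \<psi>' ` ?B}" by (rule param_open_preimage[OF 1(1)])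
  moreover have "u \<in> {y \<in> U. \<psi> y \<in> \<psi>' ` ?B}" using 1 2 eq e by auto
  ultimately obtain d where d: "d > 0" "ball u d \<subseteq> {y \<in> U. \<psi> y \<in> \<psi>' ` ?B}"
    using open_contains_ball by blast
  have "\<exists>y'. norm (y' - u') < e \<and> (F \<circ> \<psi>) y = (F \<circ> \<psi>') y'" if "norm (y - u) < d" for y
  proof -
    have "y \<in> ball u d" using that by (simp add: dist_norm norm_minus_commute)
    then obtain y' where "y' \<in> ?B" "\<psi> y = \<psi>' y'" using d(2) by auto
    then show ?thesis by (intro exI[of _ y']) (simp add: dist_norm norm_minus_commute)
  qed
  then show "\<exists>d>0. \<forall>y. norm (y - u) < d \<longrightarrow> (\<exists>y'. norm (y' - u') < e \<and> (F \<circ> \<psi>) y = (F \<circ> \<psi>') y')"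
    using d(1) by blast
qed

text \<open>Lets later computations stay in one fixed chart, although \<open>tangent\<close> is a
  union over all charts.\<close>

lemma tangent_eq_range:
  assumes "param N F U \<psi>" "u \<in> U"
  shows "tangent N F (\<psi> u) = range (frechet_derivative (F \<circ> \<psi>) (at u))"
proof
  show "tangent N F (\<psi> u) \<subseteq> range (frechet_derivative (F \<circ> \<psi>) (at u))"
    unfolding tangent_def using param_tangent_subset[OF _ _ assms] by blast
  show "range (frechet_derivative (F \<circ> \<psi>) (at u)) \<subseteq> tangent N F (\<psi> u)"
    unfolding tangent_def using assms by blast
qed

text \<open>The coordinates \<open>x + \<i> y\<close> identify the tangent space with \<open>\<complex>\<^sup>3\<close> so that \<open>J\<close> becomes
  multiplication by \<open>\<i>\<close> and \<open>P\<close> becomes complex conjugation.\<close>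

definition tcoord :: "quat \<times> quat \<Rightarrow> real ^ 3 \<Rightarrow> real ^ 3 \<Rightarrow> quat \<times> quat" where
  "tcoord z x y = (fst z \<star> imq (x + (1 / sqrt 3) *\<^sub>R y), snd z \<star> imq (x - (1 / sqrt 3) *\<^sub>R y))"

section \<open>The nearly Kaehler structure in complex coordinates\<close>

context
  fixes z :: "quat \<times> quat"
  assumes z: "norm (fst z) = 1" "norm (snd z) = 1"
begin

lemma J_op_tcoord: "J_op z (tcoord z x y) = tcoord z (- y) x"
proof -
  have 1: "(1 / sqrt 3) *\<^sub>R (2 *\<^sub>R imq (x - (1 / sqrt 3) *\<^sub>R y) - imq (x + (1 / sqrt 3) *\<^sub>R y)) = imq (- y + (1 / sqrt 3) *\<^sub>R x)"
    by (simp add: quat_eq_iff field_simps)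
  have 2: "(1 / sqrt 3) *\<^sub>R (- 2 *\<^sub>R imq (x + (1 / sqrt 3) *\<^sub>R y) + imq (x - (1 / sqrt 3) *\<^sub>R y)) = imq (- y - (1 / sqrt 3) *\<^sub>R x)"
    by (simp add: quat_eq_iff field_simps)
  show ?thesis
    unfolding J_op_def tcoord_def Let_def fst_conv snd_conv 1[symmetric] 2[symmetric]
    using z by (simp only: qcnj_cancel scaleR_Pair bounded_bilinear.scaleR_right[OF bounded_bilinear_qmult])
qed

lemma P_op_tcoord: "P_op z (tcoord z x y) = tcoord z x (- y)"
  using z by (simp add: P_op_def tcoord_def)

lemma inner_tcoord: "tcoord z x y \<bullet> tcoord z x' y' = 2 * (x \<bullet> x') + (2/3) * (y \<bullet> y')"
  unfolding tcoord_def using z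
  by (simp add: inner_qmult_left inner_add_left inner_add_right inner_diff_left inner_diff_right field_simps)

text \<open>Averaging over \<open>J\<close> exchanges the weights 2 and 2/3 of the product metric,
  which makes both equal to 4/3.\<close>

lemma g_metric_tcoord: "g_metric z (tcoord z x y) (tcoord z x' y') = (4/3) * (x \<bullet> x' + y \<bullet> y')"
  unfolding g_metric_def J_op_tcoord inner_tcoord by simp

lemma tcoord_inject: "tcoord z x y = tcoord z x' y' \<longleftrightarrow> x = x' \<and> y = y'"
proof
  assume e: "tcoord z x y = tcoord z x' y'"
  have "tcoord z (x - x') (y - y') = tcoord z x y - tcoord z x' y'"
    by (simp add: tcoord_def quat_eq_iff algebra_simps)
  then have "tcoord z (x - x') (y - y') = 0" using e by simp
  then have "2 * ((x - x') \<bullet> (x - x')) + (2/3) * ((y - y') \<bullet> (y - y')) = 0"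
    using inner_tcoord[of "x - x'" "y - y'" "x - x'" "y - y'"] by simp
  then have "(x - x') \<bullet> (x - x') = 0 \<and> (y - y') \<bullet> (y - y') = 0"
    using inner_ge_zero[of "x - x'"] inner_ge_zero[of "y - y'"] by linarith
  then show "x = x' \<and> y = y'" by simp
qed simp

end

text \<open>The kernel vector of the form \<open>(v, w) \<mapsto> g (J v, w)\<close> on the three-dimensional tangent space spans
  \<open>D1\<^sup>\<bottom>\<close>; it is polynomial in the basis, hence depends smoothly on the point.\<close>

definition kform :: "(real ^ 3 \<Rightarrow> real ^ 3) \<Rightarrow> (real ^ 3 \<Rightarrow> real ^ 3) \<Rightarrow> real ^ 3 \<Rightarrow> real ^ 3 \<Rightarrow> real" where
  "kform X Y v w = X v \<bullet> Y w - Y v \<bullet> X w"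

definition kvec :: "(real ^ 3 \<Rightarrow> real ^ 3) \<Rightarrow> (real ^ 3 \<Rightarrow> real ^ 3) \<Rightarrow> real ^ 3" where
  "kvec X Y = kform X Y (axis 2 1) (axis 3 1) *\<^sub>R axis 1 1 + kform X Y (axis 3 1) (axis 1 1) *\<^sub>R axis 2 1
     + kform X Y (axis 1 1) (axis 2 1) *\<^sub>R axis 3 1"

section \<open>Linear algebra of the condition P D1 = D2 at a point\<close>

lemma vec3_expansion: "(w :: real ^ 3) = w$1 *\<^sub>R axis 1 1 + w$2 *\<^sub>R axis 2 1 + w$3 *\<^sub>R axis 3 1"
  by (simp add: vec3_eq_iff axis_def)

lemma linear_axis_expansion:
  fixes X :: "real ^ 3 \<Rightarrow> 'b::real_vector"
  assumes "linear X"
  shows "X w = w$1 *\<^sub>R X (axis 1 1) + w$2 *\<^sub>R X (axis 2 1) + w$3 *\<^sub>R X (axis 3 1)"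
  using linear_add[OF assms] linear_scale[OF assms] by (subst vec3_expansion) simp

lemma linear_kvec:
  assumes "linear X"
  shows "X (kvec X' Y') = kform X' Y' (axis 2 1) (axis 3 1) *\<^sub>R X (axis 1 1)
    + kform X' Y' (axis 3 1) (axis 1 1) *\<^sub>R X (axis 2 1) + kform X' Y' (axis 1 1) (axis 2 1) *\<^sub>R X (axis 3 1)"
  by (simp add: kvec_def linear_add[OF assms] linear_scale[OF assms])

text \<open>A skew form on \<open>real ^ 3\<close> is the determinant of \<open>kvec\<close>,
  \<open>v\<close>, \<open>w\<close>, which has a repeated entry for \<open>v\<close> =
  \<open>kvec\<close>.\<close>

lemma kform_kvec:
  assumes "linear X" "linear Y"
  shows "kform X Y (kvec X Y) w = 0"
proof -
  have "kform X Y (kvec X Y) w = X (kvec X Y) \<bullet> Y w - Y (kvec X Y) \<bullet> X w" by (rule kform_def)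
  also have "\<dots> = 0"
    unfolding linear_kvec[OF assms(1)] linear_kvec[OF assms(2)]
      linear_axis_expansion[OF assms(1), of w] linear_axis_expansion[OF assms(2), of w]
      inner_add_left inner_add_right inner_scaleR_left inner_scaleR_right kform_def
      inner_commute[of "Y _" "X _"]
    by algebra
  finally show ?thesis .
qed

text \<open>The kernel vector s + i t lies in \<open>Dperp\<close>, hence in the conjugate of
  \<open>D\<close>. So its conjugate s - i t lies in \<open>D\<close>, and by definition of
  \<open>D\<close> also - i (s - i t) = - t - i s is tangent. These three vectors span
  \<open>T\<close>, and orthogonality to the kernel makes \<open>s\<close> and \<open>t\<close>
  orthogonal of equal length.\<close>

lemma CR_tangent_space_frame:
  fixes X Y :: "real ^ 3 \<Rightarrow> real ^ 3"
  assumes z: "norm (fst z) = 1" "norm (snd z) = 1" and lin: "linear X" "linear Y"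
    and inj: "\<And>w. X w = 0 \<Longrightarrow> Y w = 0 \<Longrightarrow> w = 0"
  defines "T \<equiv> range (\<lambda>w. tcoord z (X w) (Y w))"
  defines "D \<equiv> J_op z ` T \<inter> T"
  defines "Dperp \<equiv> {Z \<in> T. \<forall>Y\<in>D. g_metric z Z Y = 0}"
  assumes P: "P_op z ` D = {Y + Z | Y Z. Y \<in> Dperp \<and> Z \<in> J_op z ` Dperp}"
  defines "s \<equiv> X (kvec X Y)" and "t \<equiv> Y (kvec X Y)"
  defines "e1 \<equiv> (1 / norm s) *\<^sub>R s" and "e2 \<equiv> (- 1 / norm s) *\<^sub>R t"
  shows "s \<noteq> 0" "e1 \<bullet> e1 = 1" "e2 \<bullet> e2 = 1" "e1 \<bullet> e2 = 0"
    and "X w \<bullet> e2 + Y w \<bullet> e1 = 0" "X w \<bullet> cross3 e1 e2 = 0" "Y w \<bullet> cross3 e1 e2 = 0"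
    and "\<exists>v1 v2 v3. X v1 = e1 \<and> Y v1 = 0 \<and> X v2 = 0 \<and> Y v2 = e2 \<and> X v3 = - e2 \<and> Y v3 = e1"
proof -
  note J = J_op_tcoord[OF z] and Pt = P_op_tcoord[OF z] and g = g_metric_tcoord[OF z] and ti = tcoord_inject[OF z]
  have t0: "tcoord z 0 0 = 0" by (simp add: tcoord_def quat_eq_iff prod_eq_iff)
  have T: "tcoord z (X w) (Y w) \<in> T" for w by (simp add: T_def)
  have DE: "\<exists>v w. Z = tcoord z (- Y v) (X v) \<and> Z = tcoord z (X w) (Y w)" if "Z \<in> D" for Z
  proof -
    obtain W where "W \<in> T" "Z = J_op z W" "Z \<in> T" using \<open>Z \<in> D\<close> unfolding D_def by blast
    moreover then obtain v w where "W = tcoord z (X v) (Y v)" "Z = tcoord z (X w) (Y w)" by (auto simp: T_def)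
    ultimately show ?thesis using J by metis
  qed
  \<comment> \<open>Zero lies in the \<open>J\<close>-image of \<open>Dperp\<close>, so each element
    of \<open>Dperp\<close> is itself a sum of the form in \<open>P\<close>.\<close>
  have Dperp_P: "Z \<in> P_op z ` D" if "Z \<in> Dperp" for Z
  proof -
    have "0 \<in> T" using T[of 0] by (simp add: linear_0[OF lin(1)] linear_0[OF lin(2)] t0)
    moreover have "g_metric z 0 W = 0" if "W \<in> D" for W
      using g[of 0 0] that unfolding D_def T_def by (auto simp: t0)
    ultimately have "0 \<in> Dperp" by (simp add: Dperp_def)
    moreover have "J_op z 0 = 0" using J[of 0 0] by (simp add: t0)
    ultimately have "0 \<in> J_op z ` Dperp" by force
    then show ?thesis unfolding P using that by (intro CollectI exI[of _ Z] exI[of _ 0]) simp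
  qed
  define w0 where "w0 = kvec X Y"
  have k: "X w0 \<bullet> Y w = Y w0 \<bullet> X w" for w
    using kform_kvec[OF lin, of w] by (simp add: kform_def w0_def)
  \<comment> \<open>Otherwise the skew form vanishes, \<open>T\<close> is totally real and
    \<open>D\<close> is zero. Then all of \<open>T\<close> is in \<open>Dperp\<close>, hence in the
    image of zero under \<open>P\<close>, although \<open>T\<close> is not zero.\<close>
  have w0: "w0 \<noteq> 0"
  proof
    assume "w0 = 0"
    then have "w0$1 = 0" "w0$2 = 0" "w0$3 = 0" by simp_all
    then have kf: "kform X Y (axis 2 1) (axis 3 1) = 0" "kform X Y (axis 3 1) (axis 1 1) = 0" "kform X Y (axis 1 1) (axis 2 1) = 0"
      by (simp_all add: w0_def kvec_def axis_def)
    have "kform X Y v w = 0" for v w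
    proof -
      have "kform X Y v w = (v$2 * w$3 - v$3 * w$2) * kform X Y (axis 2 1) (axis 3 1)
         + (v$3 * w$1 - v$1 * w$3) * kform X Y (axis 3 1) (axis 1 1) + (v$1 * w$2 - v$2 * w$1) * kform X Y (axis 1 1) (axis 2 1)"
        unfolding kform_def linear_axis_expansion[OF lin(1), of w] linear_axis_expansion[OF lin(2), of w]
          linear_axis_expansion[OF lin(1), of v] linear_axis_expansion[OF lin(2), of v]
          inner_add_left inner_add_right inner_scaleR_left inner_scaleR_right inner_commute[of "Y _" "X _"]
        by algebra
      then show ?thesis using kf by simp
    qed
    then have kz: "X v \<bullet> Y w = Y v \<bullet> X w" for v w by (simp add: kform_def)
    have D0: "Z = 0" if "Z \<in> D" for Z
    proof -
      obtain v w where vw: "Z = tcoord z (- Y v) (X v)" "Z = tcoord z (X w) (Y w)"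
        using DE[OF \<open>Z \<in> D\<close>] by blast
      then have "X w = - Y v" "Y w = X v" by (simp_all add: ti)
      then have "X v \<bullet> X v + Y v \<bullet> Y v = 0" using kz[of v w] by simp
      then have "X v = 0" "Y v = 0"
        using inner_ge_zero[of "X v"] inner_ge_zero[of "Y v"] by (auto simp: add_nonneg_eq_0_iff)
      then show ?thesis using vw by (simp add: t0)
    qed
    define a :: "real ^ 3" where "a = axis 1 1"
    have g0: "g_metric z (tcoord z (X a) (Y a)) 0 = 0" using g[of "X a" "Y a" 0 0] by (simp add: t0)
    have "g_metric z (tcoord z (X a) (Y a)) Z = 0" if "Z \<in> D" for Z
      using D0[OF that] g0 by simp
    then have "tcoord z (X a) (Y a) \<in> Dperp" by (simp add: Dperp_def T)
    then obtain Z where "Z \<in> D" "tcoord z (X a) (Y a) = P_op z Z" using Dperp_P by blast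
    then have "tcoord z (X a) (Y a) = tcoord z 0 0" using D0[of Z] Pt[of 0 0] by (simp add: t0)
    then have "a = 0" using inj by (simp add: ti)
    then show False by (simp add: a_def axis_eq_0_iff)
  qed
  have st: "X w0 = s" "Y w0 = t" by (simp_all add: s_def t_def w0_def)
  \<comment> \<open>Elements of \<open>D\<close> are of the form \<open>J\<close> times a tangent
    vector, and \<open>k\<close> says that the kernel vector is orthogonal to all of these.\<close>
  have "tcoord z s t \<in> Dperp"
  proof -
    have "g_metric z (tcoord z s t) W = 0" if "W \<in> D" for W
    proof -
      obtain v where "W = tcoord z (- Y v) (X v)" using DE[OF \<open>W \<in> D\<close>] by blast
      then show ?thesis using k[of v] by (simp add: g st inner_commute)
    qed
    then show ?thesis using T[of w0] by (simp add: Dperp_def st)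
  qed
  then obtain Z where Z: "Z \<in> D" "tcoord z s t = P_op z Z" using Dperp_P by blast
  then obtain wa wc where wa: "Z = tcoord z (X wa) (Y wa)" and wc: "Z = tcoord z (- Y wc) (X wc)"
    using DE by blast
  have Xa: "X wa = s" "Y wa = - t" using Z(2) unfolding wa Pt ti by simp_all
  have "X wc = - t \<and> - Y wc = s" using wa wc Xa by (simp add: ti)
  then have Xc: "X wc = - t" "Y wc = - s" by (simp_all add: minus_equation_iff[of "Y wc"])
  have k': "s \<bullet> Y w = t \<bullet> X w" for w using k by (simp add: st)
  have ss: "s \<bullet> t = 0" "s \<bullet> s = t \<bullet> t" using k'[of wa] k'[of wc] by (simp_all add: Xa Xc inner_commute)
  show s0: "s \<noteq> 0"
  proof
    assume "s = 0"
    then have "t = 0" using ss by simp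
    then show False using \<open>s = 0\<close> w0 inj[of w0] by (simp add: st)
  qed
  define r where "r = norm s"
  have r: "r > 0" "s \<bullet> s = r * r" using s0 by (simp_all add: r_def dot_square_norm power2_eq_square)
  have e: "e1 = (1 / r) *\<^sub>R s" "e2 = (- 1 / r) *\<^sub>R t" by (simp_all add: e1_def e2_def r_def)
  show on: "e1 \<bullet> e1 = 1" "e2 \<bullet> e2 = 1" "e1 \<bullet> e2 = 0"
  proof -
    have "s \<bullet> s \<noteq> 0" "t \<bullet> t = r * r" using ss r by auto
    then show "e1 \<bullet> e1 = 1" "e2 \<bullet> e2 = 1" "e1 \<bullet> e2 = 0"
      using ss(1) r by (simp_all add: e del: inner_eq_zero_iff)
  qed
  show "X w \<bullet> e2 + Y w \<bullet> e1 = 0" using k'[of w] by (simp add: e inner_commute)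
  \<comment> \<open>Half the sum and half the difference of s - i t and s + i t, divided by
    \<open>r\<close>, are e1 and i e2, as t = - r e2; dividing - t - i s by \<open>- r\<close> gives
    i e1 - e2.\<close>
  define v1 v2 v3 where "v1 = (1 / (2 * r)) *\<^sub>R (w0 + wa)" and "v2 = (1 / (2 * r)) *\<^sub>R (wa - w0)" and "v3 = (- 1 / r) *\<^sub>R wc"
  have X2: "X v1 = e1" "X v2 = 0" "X v3 = - e2" and Y2: "Y v1 = 0" "Y v2 = e2" "Y v3 = e1"
    using r(1) by (simp_all add: v1_def v2_def v3_def linear_scale[OF lin(1)] linear_scale[OF lin(2)] linear_add[OF lin(1)] linear_add[OF lin(2)]
        linear_diff[OF lin(1)] linear_diff[OF lin(2)] linear_neg[OF lin(1)] linear_neg[OF lin(2)] Xa Xc st e vec3_eq_iff field_simps)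
  then show "\<exists>v1 v2 v3. X v1 = e1 \<and> Y v1 = 0 \<and> X v2 = 0 \<and> Y v2 = e2 \<and> X v3 = - e2 \<and> Y v3 = e1"
    by blast
  \<comment> \<open>The images of \<open>v1\<close>, \<open>v2\<close>, \<open>v3\<close> are
    independent, so these form a basis of \<open>real ^ 3\<close>, and the relations with the third
    frame vector extend to every \<open>w\<close>.\<close>
  define M :: "real ^ 3 \<Rightarrow> real ^ 3" where "M c = c$1 *\<^sub>R v1 + c$2 *\<^sub>R v2 + c$3 *\<^sub>R v3" for c
  have linM: "linear M" by (rule linearI) (simp_all add: M_def algebra_simps)
  have XM: "X (M c) = c$1 *\<^sub>R e1 - c$3 *\<^sub>R e2" "Y (M c) = c$2 *\<^sub>R e2 + c$3 *\<^sub>R e1" for c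
    by (simp_all add: M_def linear_scale[OF lin(1)] linear_scale[OF lin(2)] linear_add[OF lin(1)] linear_add[OF lin(2)] X2 Y2)
  have "c = 0" if "M c = 0" for c
  proof -
    have X0: "c$1 *\<^sub>R e1 - c$3 *\<^sub>R e2 = 0" and Y0: "c$2 *\<^sub>R e2 + c$3 *\<^sub>R e1 = 0"
      using XM[of c] that by (simp_all add: linear_0[OF lin(1)] linear_0[OF lin(2)])
    have e21: "e2 \<bullet> e1 = 0" using on(3) by (simp add: inner_commute)
    have "c$1 = 0" using arg_cong[OF X0, of "\<lambda>x. x \<bullet> e1"] on e21 by (simp add: inner_diff_left)
    moreover have "c$2 = 0" using arg_cong[OF Y0, of "\<lambda>x. x \<bullet> e2"] on e21 by (simp add: inner_add_left)
    moreover have "c$3 = 0" using arg_cong[OF Y0, of "\<lambda>x. x \<bullet> e1"] on e21 by (simp add: inner_add_left)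
    ultimately show ?thesis by (simp add: vec3_eq_iff)
  qed
  then have "inj M" by (simp add: linear_injective_0[OF linM])
  then have "surj M" by (rule linear_inj_imp_surj[OF linM])
  then obtain c where c: "w = M c" by (metis surjD)
  have f: "e1 \<bullet> cross3 e1 e2 = 0" "e2 \<bullet> cross3 e1 e2 = 0" by (simp_all add: dot_cross_self)
  show "X w \<bullet> cross3 e1 e2 = 0" "Y w \<bullet> cross3 e1 e2 = 0"
    unfolding c XM using f by (simp_all add: inner_add_left inner_diff_left)
qed

section \<open>Local congruence\<close>

text \<open>Inside one chart, the pointwise frames are assembled into smooth fields
  \<open>e1\<close>, \<open>e2\<close>, to which \<open>adapted_frame_congruence\<close> applies on
  a small ball.\<close>

lemma param_local_congruence:
  assumes par: "param N F U \<psi>" and u0: "u0 \<in> U" and S3: "F ` topspace N \<subseteq> S3 \<times> S3"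
    and P: "\<And>x. x \<in> topspace N \<Longrightarrow> P_op (F x) ` D1 N F x = D2 N F x"
  shows "\<exists>W V a b c. openin N W \<and> \<psi> u0 \<in> W \<and> inj_on F W \<and> open V \<and>
    norm a = 1 \<and> norm b = 1 \<and> norm c = 1 \<and>
    F ` W = isom a b c ` model ((1/2) *\<^sub>R qone) ((1/2) *\<^sub>R qone) ` V"
proof -
  define f where "f = F \<circ> \<psi>"
  define p where "p u = fst (f u)" for u
  define q where "q u = snd (f u)" for u
  have U: "open U" and f: "Ck_on k U f" and imm: "u \<in> U \<Longrightarrow> inj (frechet_derivative f (at u))"
    and top: "\<psi> ` U \<subseteq> topspace N" for k u
    using par unfolding param_def smooth_on_def f_def by (auto dest: openin_subset)
  have pq: "Ck_on k U p" "Ck_on k U q" for k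
    unfolding p_def q_def using f
    by (auto intro!: Ck_on_bounded_linear[OF U bounded_linear_fst] Ck_on_bounded_linear[OF U bounded_linear_snd])
  have n: "norm (p u) = 1" "norm (q u) = 1" if "u \<in> U" for u
    using that top S3 by (force simp: p_def q_def f_def S3_def)+
  \<comment> \<open>Chosen so that \<open>mcform p\<close> is X + Y / sqrt 3 and
    \<open>mcform q\<close> is X - Y / sqrt 3; thus \<open>X\<close> and \<open>Y\<close> are the
    real and imaginary parts of the differential in the coordinates \<open>tcoord\<close>.\<close>
  define X where "X w u = (1/2) *\<^sub>R (mcform p w u + mcform q w u)" for w u
  define Y where "Y w u = (sqrt 3/2) *\<^sub>R (mcform p w u - mcform q w u)" for w u
  have CXY: "Ck_on k U (X w)" "Ck_on k U (Y w)" for k w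
    unfolding X_def Y_def
    by (intro Ck_on_bounded_linear[OF U bounded_linear_scaleR_right] Ck_on_add Ck_on_diff U Ck_on_mcform pq)+
  have df: "frechet_derivative f (at u) w = tcoord (f u) (X w u) (Y w u)" if u: "u \<in> U" for u w
  proof -
    have d: "(f has_derivative frechet_derivative f (at u)) (at u)"
      using Ck_on_has_derivative[OF f u] .
    have "dder p w u = fst (dder f w u)" "dder q w u = snd (dder f w u)"
      unfolding p_def q_def by (rule dder_eqI[OF has_derivative_fst[OF d]] dder_eqI[OF has_derivative_snd[OF d]])+
    moreover have "dder p w u = p u \<star> imq (mcform p w u)" "dder q w u = q u \<star> imq (mcform q w u)"
      using n by (auto intro!: dder_eq_mcform[OF U pq(1) _ u] dder_eq_mcform[OF U pq(2) _ u])
    moreover have "mcform p w u = X w u + (1 / sqrt 3) *\<^sub>R Y w u" "mcform q w u = X w u - (1 / sqrt 3) *\<^sub>R Y w u"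
      unfolding X_def Y_def by (simp_all add: vec3_eq_iff field_simps)
    ultimately show ?thesis by (simp add: tcoord_def prod_eq_iff p_def[symmetric] q_def[symmetric])
  qed
  have lin: "linear (\<lambda>w. X w u)" "linear (\<lambda>w. Y w u)" if u: "u \<in> U" for u
  proof -
    have m: "linear (\<lambda>w. mcform p w u)" "linear (\<lambda>w. mcform q w u)"
      unfolding mcform_def
      using Ck_on_has_derivative[OF pq(1) u, THEN has_derivative_bounded_linear] Ck_on_has_derivative[OF pq(2) u, THEN has_derivative_bounded_linear]
      by (auto intro!: bounded_linear.linear bounded_linear_compose[OF bounded_linear_qim]
        bounded_linear_compose[OF bounded_bilinear.bounded_linear_right[OF bounded_bilinear_qmult]])
    show "linear (\<lambda>w. X w u)" "linear (\<lambda>w. Y w u)"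
      unfolding X_def Y_def by (intro linear_compose_scale_right linear_compose_add linear_compose_sub m)+
  qed
  define s where "s u = X (kvec (\<lambda>w. X w u) (\<lambda>w. Y w u)) u" for u
  define t where "t u = Y (kvec (\<lambda>w. X w u) (\<lambda>w. Y w u)) u" for u
  define e1 where "e1 u = (1 / norm (s u)) *\<^sub>R s u" for u
  define e2 where "e2 u = (- 1 / norm (s u)) *\<^sub>R t u" for u
  have frame: "s u \<noteq> 0" "e1 u \<bullet> e1 u = 1" "e2 u \<bullet> e2 u = 1" "e1 u \<bullet> e2 u = 0"
    "\<And>w. X w u \<bullet> e2 u + Y w u \<bullet> e1 u = 0"
    "\<And>w. X w u \<bullet> cross3 (e1 u) (e2 u) = 0" "\<And>w. Y w u \<bullet> cross3 (e1 u) (e2 u) = 0"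
    "\<exists>v1 v2 v3. X v1 u = e1 u \<and> Y v1 u = 0 \<and> X v2 u = 0 \<and> Y v2 u = e2 u \<and> X v3 u = - e2 u \<and> Y v3 u = e1 u"
    if u: "u \<in> U" for u
  proof -
    have z: "norm (fst (f u)) = 1" "norm (snd (f u)) = 1" using n[OF u] by (simp_all add: p_def q_def)
    have T: "tangent N F (\<psi> u) = range (\<lambda>w. tcoord (f u) (X w u) (Y w u))"
      using tangent_eq_range[OF par u] df[OF u] by (simp add: f_def[symmetric])
    have inj: "w = 0" if "X w u = 0" "Y w u = 0" for w
    proof -
      have "dder f w u = dder f 0 u"
        unfolding df[OF u] that linear_0[OF lin(1)[OF u]] linear_0[OF lin(2)[OF u]] ..
      then show ?thesis using imm[OF u] by (auto dest: injD)
    qed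
    have "\<psi> u \<in> topspace N" using top u by blast
    from P[OF this] have P': "P_op (f u) ` (J_op (f u) ` tangent N F (\<psi> u) \<inter> tangent N F (\<psi> u)) =
      {Y + Z | Y Z. Y \<in> {Z \<in> tangent N F (\<psi> u). \<forall>Y\<in>J_op (f u) ` tangent N F (\<psi> u) \<inter> tangent N F (\<psi> u). g_metric (f u) Z Y = 0} \<and>
         Z \<in> J_op (f u) ` {Z \<in> tangent N F (\<psi> u). \<forall>Y\<in>J_op (f u) ` tangent N F (\<psi> u) \<inter> tangent N F (\<psi> u). g_metric (f u) Z Y = 0}}"
      unfolding D1_def D2_def perp_in_tangent_def f_def comp_def .
    note fr = CR_tangent_space_frame[OF z lin[OF u] inj P'[unfolded T], folded s_def t_def, folded e1_def e2_def]
    show "s u \<noteq> 0" "e1 u \<bullet> e1 u = 1" "e2 u \<bullet> e2 u = 1" "e1 u \<bullet> e2 u = 0"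
      "\<And>w. X w u \<bullet> e2 u + Y w u \<bullet> e1 u = 0"
      "\<And>w. X w u \<bullet> cross3 (e1 u) (e2 u) = 0" "\<And>w. Y w u \<bullet> cross3 (e1 u) (e2 u) = 0"
      "\<exists>v1 v2 v3. X v1 u = e1 u \<and> Y v1 u = 0 \<and> X v2 u = 0 \<and> Y v2 u = e2 u \<and> X v3 u = - e2 u \<and> Y v3 u = e1 u"
      by (rule fr; assumption)+
  qed
  have Ckf: "Ck_on k U (\<lambda>u. kform (\<lambda>w. X w u) (\<lambda>w. Y w u) v w)" for k v w
    unfolding kform_def by (intro Ck_on_diff Ck_on_bilinear[OF U bounded_bilinear_inner] U CXY)
  let ?k = "\<lambda>v w u. kform (\<lambda>w. X w u) (\<lambda>w. Y w u) v w"
  \<comment> \<open>The vector inserted into \<open>Z\<close> varies with \<open>u\<close> as well;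
    linearity rewrites the value as a combination of fixed directions with smooth
    coefficients.\<close>
  have Ckv: "Ck_on k U (\<lambda>u. Z (kvec (\<lambda>w. X w u) (\<lambda>w. Y w u)) u)"
    if Z: "\<And>w. Ck_on k U (Z w)" and Zl: "\<And>u. u \<in> U \<Longrightarrow> linear (\<lambda>w. Z w u)"
    for k and Z :: "real ^ 3 \<Rightarrow> real ^ 3 \<Rightarrow> real ^ 3"
  proof (rule Ck_on_cong[OF U])
    show "Ck_on k U (\<lambda>u. ?k (axis 2 1) (axis 3 1) u *\<^sub>R Z (axis 1 1) u
        + ?k (axis 3 1) (axis 1 1) u *\<^sub>R Z (axis 2 1) u + ?k (axis 1 1) (axis 2 1) u *\<^sub>R Z (axis 3 1) u)"
      by (intro Ck_on_add Ck_on_bilinear[OF U bounded_bilinear_scaleR] U Z Ckf)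
  qed (rule linear_kvec[OF Zl, symmetric])
  have Cs: "Ck_on k U s" and Ct: "Ck_on k U t" for k
    using Ckv[of k X, OF CXY(1) lin(1)] Ckv[of k Y, OF CXY(2) lin(2)]
    unfolding s_def[abs_def] t_def[abs_def] by blast+
  \<comment> \<open>As \<open>s\<close> never vanishes, its squared norm stays in the range where
    real powers are smooth.\<close>
  have Cr: "Ck_on k U (\<lambda>u. 1 / norm (s u))" for k
  proof (rule Ck_on_cong[OF U])
    show "Ck_on k U (\<lambda>u. (s u \<bullet> s u) powr (- 1/2))"
      using frame(1) by (intro Ck_on_powr[OF U] Ck_on_bilinear[OF U bounded_bilinear_inner] Cs) simp
    show "(s u \<bullet> s u) powr (- 1/2) = 1 / norm (s u)" if "u \<in> U" for u
      using frame(1)[OF that] by (simp add: norm_eq_sqrt_inner powr_minus_divide powr_half_sqrt)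
  qed
  have Ce: "Ck_on k U e1" "Ck_on k U e2" for k
  proof -
    show "Ck_on k U e1" unfolding e1_def[abs_def] by (intro Ck_on_bilinear[OF U bounded_bilinear_scaleR] Cr Cs)
    have "Ck_on k U (\<lambda>u. - ((1 / norm (s u)) *\<^sub>R t u))"
      by (intro Ck_on_bounded_linear[OF U bounded_linear_minus[OF bounded_linear_ident]] Ck_on_bilinear[OF U bounded_bilinear_scaleR] Cr Ct)
    then show "Ck_on k U e2" by (simp add: e2_def[abs_def])
  qed
  \<comment> \<open>A ball is convex, as the lifting of angles and the constancy arguments require,
    and a small one makes \<open>f\<close> injective.\<close>
  obtain r where r: "r > 0" "ball u0 r \<subseteq> U" "inj_on f (ball u0 r)"
    using immersion_locally_injective[OF U f u0 imm[OF u0]] .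
  define B where "B = ball u0 r"
  have B: "open B" "convex B" "B \<noteq> {}" "B \<subseteq> U" "u0 \<in> B" using r by (auto simp: B_def)
  obtain a b c h where h: "norm a = 1" "norm b = 1" "norm c = 1" "continuous_on B h"
    "\<And>u. u \<in> B \<Longrightarrow> (p u, q u) = isom a b c (model ((1/2) *\<^sub>R qone) ((1/2) *\<^sub>R qone) (h u))"
    by (rule adapted_frame_congruence[of B e1 e2 p q, folded X_def Y_def, OF B(1-3) Ck_on_subset[OF Ce(1) B(4)]
        Ck_on_subset[OF Ce(2) B(4)] Ck_on_subset[OF pq(1) B(4)] Ck_on_subset[OF pq(2) B(4)]])
      (use n frame B(4) in \<open>auto simp: subset_iff\<close>)
  have fh: "f u = isom a b c (model ((1/2) *\<^sub>R qone) ((1/2) *\<^sub>R qone) (h u))" if "u \<in> B" for u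
    using h(5)[OF that] by (simp add: p_def q_def)
  \<comment> \<open>The injective map \<open>f\<close> factors through \<open>h\<close>, so
    \<open>h\<close> is injective; invariance of domain then makes its image open.\<close>
  have "inj_on h B"
    using r(3) fh by (auto simp: inj_on_def B_def)
  then have oV: "open (h ` B)"
    using h(4) B(1) by (intro invariance_of_domain_gen) auto
  have W: "openin N (\<psi> ` B)" by (rule param_openin_image[OF par B(1,4)])
  have FW: "F ` \<psi> ` B = isom a b c ` model ((1/2) *\<^sub>R qone) ((1/2) *\<^sub>R qone) ` h ` B"
    using fh unfolding image_image by (intro image_cong) (auto simp: f_def)
  have "inj_on F (\<psi> ` B)"
    using r(3) unfolding f_def B_def by (rule inj_on_imageI)
  then show ?thesis using W oV FW h(1-3) B(5) by blast
qed

theorem theorem4: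
  fixes N :: "'n topology" and F :: "'n \<Rightarrow> quat \<times> quat"
  assumes "proper_CR_submanifold3 N F"
    and "\<And>x. x \<in> topspace N \<Longrightarrow> P_op (F x) ` D1 N F x = D2 N F x"
  shows "\<exists>A E :: quat. norm A = 1 / 2 \<and> norm E = 1 / 2 \<and> locally_congruent N F (model A E)"
proof -
  have sub: "submanifold3 N F"
    using assms(1) by (simp add: proper_CR_submanifold3_def CR_submanifold3_def)
  \<comment> \<open>The choice A = E = 1/2 suffices: the unit factors \<open>a\<close> and
    \<open>b\<close> in \<open>isom\<close> absorb every other constant of norm 1/2.\<close>
  have "locally_congruent N F (model ((1/2) *\<^sub>R qone) ((1/2) *\<^sub>R qone))"
    unfolding locally_congruent_def
  proof
    fix x assume "x \<in> topspace N"
    then obtain U \<psi> u where "param N F U \<psi>" "u \<in> U" "x = \<psi> u" "F ` topspace N \<subseteq> S3 \<times> S3"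
      using sub unfolding submanifold3_def by blast
    then show "\<exists>W V a b c. openin N W \<and> x \<in> W \<and> inj_on F W \<and> open V \<and>
        norm a = 1 \<and> norm b = 1 \<and> norm c = 1 \<and>
        F ` W = isom a b c ` model ((1/2) *\<^sub>R qone) ((1/2) *\<^sub>R qone) ` V"
      using param_local_congruence[OF _ _ _ assms(2)] by simp
  qed
  moreover have "norm ((1/2) *\<^sub>R qone) = 1/2"
    using norm_eq_1_quat[of qone] by simp
  ultimately show ?thesis by blast
qed

end
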